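(* There exists an absolute constant $a\geq 1$ such that for every subharmonic function $u\not\equiv-\infty$ on $\mathbb{C}$, all numbers $0\leq r_0\leq r<R<+\infty$, every measurable subset $E\subset[r,R]$, every measurable function $g$ on $E$ (with values in $[-\infty,+\infty]$), and every number $b\in(0,1]$, the following inequality holds: $$ \int_{E}\mathsf{M}_{|u|}\,g\,d\lambda\leq \left(\frac{a}{b}\ln\frac{a}{b}\right)\Bigl(\mathsf{M}_u\bigl((1+b)R\bigr)-2\min\bigl\{0,\mathsf{C}_u(r_0)\bigr\}\Bigr)\Bigl(\operatorname{ess\,sup}_{E}|g|\Bigr)\left(\operatorname{mes}E+\min\{\operatorname{mes}E,3bR\}\ln\frac{3ebR}{\min\{\operatorname{mes}E,3bR\}}\right). $$
   Context: $\lambda$ is linear Lebesgue measure on $\mathbb{R}$, $\operatorname{mes}E:=\lambda(E)$; measurability and integrals over $E$ are with respect to $\lambda$, and the integral notation is used when the Lebesgue integral is well defined in $[-\infty,+\infty]$. For $\rho\geq 0$ and a function $v$ on the circle $\{|z|=\rho\}$ with values in $[-\infty,+\infty]$: $\mathsf{M}_v(\rho):=\sup_{|z|=\rho}v(z)$, and $\mathsf{C}_v(\rho):=\frac1{2\pi}\int_0^{2\pi}v(\rho e^{is})\,ds$ (when this integral is well defined); in particular $\mathsf{M}_v(0)=\mathsf{C}_v(0)=v(0)$. Thus $\mathsf{M}_{|u|}$ is the function $\rho\mapsto\sup_{|z|=\rho}|u(z)|\in[0,+\infty]$, where $|-\infty|=+\infty$. $\operatorname{ess\,sup}_E f:=\inf\{c\in\mathbb{R}:\lambda(\{x\in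 E: f(x)>c\})=0\}$. Conventions in the extended real line: $x\pm(+\infty)=\pm\infty$ for finite $x$; $x\cdot(\pm\infty)=\pm\infty$ for $x\in(0,+\infty]$, with the opposite sign for negative $x$; $0\cdot(\pm\infty)=0$; $x/0=+\infty$ for $x>0$; $\ln(+\infty)=+\infty$. In particular, if $\operatorname{mes}E=0$ the right-hand side equals $0$. *)

theory Defs
  imports "HOL-Analysis.Analysis" "HOL-Probability.Essential_Supremum"
begin

(* Lebesgue integral with values in [-\<infinity>, \<infinity>]: integral of the positive part minus
   integral of the negative part (e2ennreal sends negative values to 0).  It is the usual
   integral whenever one of the two parts is finite; otherwise the value is
   \<infinity> - \<infinity> = \<infinity> in ereal, so an upper bound by a number < \<infinity> always implies that the
   integral of the positive part is finite. *)
definition ereal_integral :: "'a measure \<Rightarrow> ('a \<Rightarrow> ereal) \<Rightarrow> ereal" where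
  "ereal_integral M f =
     enn2ereal (\<integral>\<^sup>+ x. e2ennreal (f x) \<partial>M) - enn2ereal (\<integral>\<^sup>+ x. e2ennreal (- f x) \<partial>M)"

definition circle_sup :: "(complex \<Rightarrow> ereal) \<Rightarrow> real \<Rightarrow> ereal" where
  "circle_sup v \<rho> = (SUP z \<in> sphere 0 \<rho>. v z)"

definition circle_mean :: "(complex \<Rightarrow> ereal) \<Rightarrow> real \<Rightarrow> ereal" where
  "circle_mean v \<rho> =
     ereal_integral (lebesgue_on {0..2 * pi}) (\<lambda>s. v (of_real \<rho> * exp (\<i> * of_real s)))
       / ereal (2 * pi)"

(* The integrals over circles in the sub-mean value inequality are always well defined:
   an upper semicontinuous function without the value \<infinity> is bounded above on compact sets.
   The function that is identically -\<infinity> is not excluded here. *)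
definition subharmonic :: "(complex \<Rightarrow> ereal) \<Rightarrow> bool" where
  "subharmonic u \<longleftrightarrow>
     (\<forall>z. u z < \<infinity>) \<and>
     (\<forall>c. open {z. u z < c}) \<and>
     (\<forall>z. \<forall>\<rho>>0. u z \<le> circle_mean (\<lambda>w. u (z + w)) \<rho>)"

end

theory Submission
  imports Defs "HOL-Complex_Analysis.Cauchy_Integral_Formula" "HOL-Probability.Probability_Measure"
begin

text \<open>
  Write \<open>M\<close> for the maximum of \<open>u\<close> on the circle of radius \<open>(1 + b) R\<close> and \<open>C\<close> for the mean of \<open>u\<close> on the
  circle of radius \<open>r0\<close>.  If \<open>C = -\<infinity>\<close>, the second factor on the right-hand side is \<open>\<infinity>\<close>.  Otherwise
  \<open>M\<close> is finite, and by the maximum principle (\<open>subharmonic_max_principle\<close>) the function \<open>M - u\<close> is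
  nonnegative and superharmonic in the disc of radius \<open>(1 + b) R\<close>, with mean at most \<open>M - C\<close> on the
  circle of radius \<open>r0\<close>.  Since \<open>\<bar>u\<bar> \<le> \<bar>M\<bar> + (M - u)\<close> there, everything reduces to the estimate

    \<open>\<integral>\<^sub>E sup {v z | \<bar>z\<bar> = t} dt \<le> K * (mean of v on the circle of radius r0)\<close>

  for superharmonic \<open>v \<ge> 0\<close>, where \<open>K\<close> is of the order of \<open>m / b * (1 + ln (R / m))\<close> and \<open>m\<close> is the measure
  of \<open>E\<close>.  Truncation makes \<open>v\<close> bounded, and the supremum over the circle may be replaced by
  \<open>v (z t)\<close> with a measurable choice of \<open>z t\<close>, \<open>\<bar>z t\<bar> = t\<close>
  (\<open>exists_maximizing_selection\<close>, \<open>circle_sup_abs_le_SUP_trunc\<close>, monotone convergence).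

  The estimate itself is a domination principle, obtained by duality and without the Riesz measure of
  \<open>v\<close>.  Let \<open>\<nu>\<close> be the image of Lebesgue measure on \<open>E\<close> under \<open>z\<close>, let \<open>\<sigma>\<close> be the uniform
  distribution on the circle of radius \<open>r0\<close>, and let \<open>\<Phi>\<close> be the logarithmic potential of
  \<open>\<nu> - K \<sigma>\<close> plus a constant.  If \<open>\<Phi> \<ge> 0\<close> in a neighbourhood of the disc of radius \<open>R\<close> and \<open>\<Phi> \<le> 0\<close>
  outside a slightly larger disc, then the positive part of \<open>\<Phi>\<close> is a compactly supported test
  function \<open>\<phi> \<ge> 0\<close>.  Superharmonicity of \<open>v\<close>, moved to \<open>\<phi>\<close> by Fubini and translation invariance, says that
  the integral of \<open>v\<close> against (circle mean of \<open>\<phi>\<close>) \<open>- \<phi>\<close> is at most \<open>0\<close>, whereas this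
  function is at least a mollification of \<open>\<nu> - K \<sigma>\<close>.  This is \<open>mollified_domination\<close>; letting the scale of
  mollification tend to \<open>0\<close> gives \<open>superharmonic_domination\<close>: \<open>\<integral> v d\<nu> \<le> K \<integral> v d\<sigma>\<close>.

  The sign conditions on \<open>\<Phi>\<close> follow from elementary bounds.  Since \<open>\<bar>w - z t\<bar> \<ge> \<bar>\<bar>w\<bar> - t\<bar>\<close>, the potential
  of \<open>\<nu>\<close> is at least \<open>m ln m - 8 m\<close> whatever the angles of the points \<open>z t\<close> are (\<open>logpot_lower\<close>), and
  the potential of \<open>\<sigma>\<close> is essentially \<open>ln (max \<bar>w\<bar> r0)\<close> (\<open>cavg_lnt_eq\<close>, \<open>cavg_lnt_le\<close>); the factor
  \<open>1 / b\<close> in \<open>K\<close> is the price for the narrow room between \<open>R\<close> and \<open>(1 + b) R\<close>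
  (\<open>superharmonic_selection_bound\<close>).  The theorem holds with \<open>a = 100\<close> (\<open>numeric_bound\<close>).
\<close>

section \<open>Averages over circles\<close>

text \<open>The uniform distribution of the angle on \<open>[0, 2 \<pi>]\<close>.\<close>
definition circ :: "real measure" where
  "circ = uniform_measure lborel {0..2 * pi}"

text \<open>The mean of a real function over the circle with centre \<open>z\<close> and radius \<open>\<bar>h\<bar>\<close>.  A negative \<open>h\<close>
  is allowed: it traverses the same circle with opposite points exchanged, which is the form in which the
  adjoint of the averaging operator appears.\<close>
definition cavg :: "(complex \<Rightarrow> real) \<Rightarrow> complex \<Rightarrow> real \<Rightarrow> real" where
  "cavg f z h = (\<integral>s. f (z + of_real h * cis s) \<partial>circ)"

interpretation circ: prob_space circ
  unfolding circ_def by (rule prob_space_uniform_measure) auto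

lemma sets_circ [simp, measurable_cong]: "sets circ = sets borel"
  by (simp add: circ_def)

lemma space_circ [simp]: "space circ = UNIV"
  by (simp add: circ_def)

lemma circ_eq_density: "circ = density lborel (\<lambda>s. ennreal (indicator {0..2*pi} s / (2 * pi)))"
  unfolding circ_def uniform_measure_def
  using divide_ennreal[of 1 "2 * pi"] by (intro density_cong) (auto split: split_indicator)

lemma circ_integral:
  fixes f :: "real \<Rightarrow> real"
  assumes [measurable]: "f \<in> borel_measurable borel"
  shows "(\<integral>s. f s \<partial>circ) = (\<integral>s\<in>{0..2*pi}. f s \<partial>lborel) / (2 * pi)"
  unfolding circ_eq_density set_lebesgue_integral_def
  by (subst integral_real_density) (auto simp: field_simps)

lemma circ_integrable:
  fixes f :: "real \<Rightarrow> real"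
  assumes "f \<in> borel_measurable borel" "\<And>s. \<bar>f s\<bar> \<le> B"
  shows "integrable circ f"
proof (rule circ.integrable_const_bound[where B=B])
  show "f \<in> borel_measurable circ" using assms(1) by measurable
qed (use assms in auto)

lemma circ_integral_shift:
  fixes f :: "real \<Rightarrow> real"
  assumes [measurable]: "f \<in> borel_measurable borel"
    and B: "\<And>s. \<bar>f s\<bar> \<le> B" and per: "\<And>s. f (s + 2 * pi) = f s" and \<alpha>: "0 \<le> \<alpha>" "\<alpha> \<le> 2 * pi"
  shows "(\<integral>s. f (s + \<alpha>) \<partial>circ) = (\<integral>s. f s \<partial>circ)"
proof -
  have int: "set_integrable lborel {a..b} f" for a b
    unfolding set_integrable_def
    by (rule integrableI_bounded_set[where A="{a..b}" and B=B])
       (use B in \<open>auto simp: indicator_def emeasure_lborel_Icc_eq\<close>)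
  have shift: "(\<integral>s\<in>{a..b}. f (s + c) \<partial>lborel) = (\<integral>s\<in>{a+c..b+c}. f s \<partial>lborel)" for a b c
    unfolding set_lebesgue_integral_def
    by (subst (2) lborel_integral_real_affine[where c=1 and t=c])
       (auto simp: indicator_def add.commute intro!: Bochner_Integration.integral_cong)
  have split: "(\<integral>s\<in>{a..c}. f s \<partial>lborel) = (\<integral>s\<in>{a..b}. f s \<partial>lborel) + (\<integral>s\<in>{b..c}. f s \<partial>lborel)"
    if "a \<le> b" "b \<le> c" for a b c
  proof -
    have "(\<integral>s\<in>{a..b} \<union> {b..c}. f s \<partial>lborel) = (\<integral>s\<in>{a..b}. f s \<partial>lborel) + (\<integral>s\<in>{b..c}. f s \<partial>lborel)"
    proof (rule set_integral_Un_AE)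
      show "AE x in lborel. \<not> (x \<in> {a..b} \<and> x \<in> {b..c})"
        using AE_lborel_singleton[of b] by eventually_elim auto
    qed (use int in auto)
    then show ?thesis using that by (simp add: ivl_disj_un_two_touch)
  qed
  have "(\<integral>s\<in>{0..2*pi}. f (s + \<alpha>) \<partial>lborel) = (\<integral>s\<in>{\<alpha>..2*pi + \<alpha>}. f s \<partial>lborel)"
    using shift[of 0 "2*pi" \<alpha>] by simp
  also have "\<dots> = (\<integral>s\<in>{\<alpha>..2*pi}. f s \<partial>lborel) + (\<integral>s\<in>{2*pi..2*pi+\<alpha>}. f s \<partial>lborel)"
    using \<alpha> by (intro split) auto
  also have "(\<integral>s\<in>{2*pi..2*pi+\<alpha>}. f s \<partial>lborel) = (\<integral>s\<in>{0..\<alpha>}. f s \<partial>lborel)"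
    using shift[of 0 \<alpha> "2*pi"] by (simp add: per add.commute)
  also have "(\<integral>s\<in>{\<alpha>..2*pi}. f s \<partial>lborel) + (\<integral>s\<in>{0..\<alpha>}. f s \<partial>lborel) = (\<integral>s\<in>{0..2*pi}. f s \<partial>lborel)"
    using \<alpha> split[of 0 \<alpha> "2*pi"] by simp
  finally show ?thesis by (simp add: circ_integral)
qed

text \<open>The mean value property of the harmonic function \<open>\<zeta> \<mapsto> ln \<bar>\<zeta>\<bar>\<close> away from the origin, from the Cauchy
  integral formula for \<open>Ln (1 + u / w)\<close> at the centre.\<close>
lemma cavg_ln_norm:
  assumes h: "\<bar>h\<bar> < norm w"
  shows "cavg (\<lambda>\<zeta>. ln (norm \<zeta>)) w h = ln (norm w)"
proof (cases "h = 0")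
  case True
  then show ?thesis by (simp add: cavg_def circ.prob_space[simplified])
next
  case False
  have w0: "w \<noteq> 0" using h by auto
  \<comment> \<open>The sign of the radius is absorbed into the integrand, since the integral formula needs a positive radius.\<close>
  define \<sigma> where "\<sigma> = complex_of_real (sgn h)"
  have \<sigma>: "norm \<sigma> = 1" "\<And>t. \<sigma> * (of_real \<bar>h\<bar> * t) = of_real h * t"
    using False by (auto simp: \<sigma>_def sgn_if)
  define f where "f = (\<lambda>u. Ln (1 + \<sigma> * u / w))"
  define g where "g = (\<lambda>u. ln (norm (w + \<sigma> * u)) - ln (norm w))"
  have nz: "1 + \<sigma> * u / w \<notin> \<real>\<^sub>\<le>\<^sub>0" if "norm u \<le> \<bar>h\<bar>" for u
  proof -
    have "norm (\<sigma> * u / w) < 1" using that h w0 by (simp add: norm_divide norm_mult \<sigma> divide_simps)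
    then have "\<bar>Re (\<sigma> * u / w)\<bar> < 1" using abs_Re_le_cmod[of "\<sigma> * u/w"] by linarith
    then have "Re (1 + \<sigma> * u / w) > 0" by simp
    then show ?thesis by (metis complex_nonpos_Reals_iff linorder_not_less)
  qed
  have hol: "f holomorphic_on cball 0 \<bar>h\<bar>"
    unfolding f_def using nz w0 by (intro holomorphic_intros) auto
  have Re_f: "Re (f u) = g u" if "norm u \<le> \<bar>h\<bar>" for u
  proof -
    have n0: "1 + \<sigma> * u / w \<noteq> 0" using nz[OF that] by auto
    then have "Re (f u) = ln (norm (1 + \<sigma> * u / w))" by (simp add: f_def)
    also have eq: "1 + \<sigma> * u / w = (w + \<sigma> * u) / w" using w0 by (simp add: field_simps)
    also have "ln (norm ((w + \<sigma> * u) / w)) = g u"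
    proof -
      have "w + \<sigma> * u \<noteq> 0" using n0 eq by auto
      then show ?thesis using w0 by (simp add: g_def norm_divide ln_div)
    qed
    finally show ?thesis .
  qed
  have h0: "\<bar>h\<bar> > 0" using False by simp
  have "((\<lambda>u. f u / (u - 0)) has_contour_integral (2 * of_real pi * \<i> * f 0)) (circlepath 0 \<bar>h\<bar>)"
  proof (rule Cauchy_integral_circlepath)
    show "continuous_on (cball 0 \<bar>h\<bar>) f" using hol holomorphic_on_imp_continuous_on by blast
    show "f holomorphic_on ball 0 \<bar>h\<bar>" using hol by (rule holomorphic_on_subset) auto
  qed (use h0 in auto)
  then have "((\<lambda>t. f (0 + of_real \<bar>h\<bar> * cis t) / (0 + of_real \<bar>h\<bar> * cis t - 0) * of_real \<bar>h\<bar> * \<i> * cis t)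
      has_integral (2 * of_real pi * \<i> * f 0)) {0..2*pi}"
    unfolding circlepath_def by (subst (asm) has_contour_integral_part_circlepath_iff) auto
  moreover have "f (0 + of_real \<bar>h\<bar> * cis t) / (0 + of_real \<bar>h\<bar> * cis t - 0) * of_real \<bar>h\<bar> * \<i> * cis t
      = \<i> * f (of_real \<bar>h\<bar> * cis t)" for t
    using h0 by (simp add: divide_simps)
  ultimately have "((\<lambda>t. \<i> * f (of_real \<bar>h\<bar> * cis t)) has_integral (2 * of_real pi * \<i> * f 0)) {0..2*pi}"
    by (simp only:)
  then have "((Im \<circ> (\<lambda>t. \<i> * f (of_real \<bar>h\<bar> * cis t))) has_integral Im (2 * of_real pi * \<i> * f 0)) {0..2*pi}"
    by (rule has_integral_linear[OF _ bounded_linear_Im])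
  moreover have "Im (2 * of_real pi * \<i> * f 0) = 0" by (simp add: f_def)
  moreover have "(Im \<circ> (\<lambda>t. \<i> * f (of_real \<bar>h\<bar> * cis t)))
      = (\<lambda>t. ln (norm (w + of_real h * cis t)) - ln (norm w))"
    using Re_f by (auto simp: o_def norm_mult g_def \<sigma>(2))
  ultimately have I: "((\<lambda>t. ln (norm (w + of_real h * cis t)) - ln (norm w)) has_integral 0) {0..2*pi}"
    by (simp only:)
  have neq: "w + of_real h * cis t \<noteq> 0" for t
  proof
    assume "w + of_real h * cis t = 0"
    then have "norm w = norm (of_real h * cis t)" by (metis add_eq_0_iff norm_minus_cancel)
    then show False using h by (simp add: norm_mult)
  qed
  define F where "F = (\<lambda>t. ln (norm (w + of_real h * cis t)) - ln (norm w))"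
  have cont: "continuous_on A F" for A
    unfolding F_def using neq w0 by (intro continuous_intros) auto
  have meas [measurable]: "F \<in> borel_measurable borel"
    using cont by (rule borel_measurable_continuous_onI)
  have "integrable lborel (\<lambda>s. indicator {0..2*pi} s *\<^sub>R F s)"
    by (rule borel_integrable_compact[OF compact_Icc cont])
  then have "(\<integral>s\<in>{0..2*pi}. F s \<partial>lborel) = integral {0..2*pi} F"
    by (intro set_borel_integral_eq_integral) (simp add: set_integrable_def)
  also have "\<dots> = 0"
    using I integral_unique unfolding F_def by blast
  finally have F0: "(\<integral>s. F s \<partial>circ) = 0" by (simp add: circ_integral)
  have "integrable lborel (\<lambda>s. (indicator {0..2*pi} s *\<^sub>R F s) / (2 * pi))"
    by (intro integrable_divide borel_integrable_compact[OF compact_Icc cont])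
  then have "integrable circ F"
    unfolding circ_eq_density
    by (subst integrable_real_density) (simp_all add: mult.commute)
  then have "(\<integral>s. F s + ln (norm w) \<partial>circ) = ln (norm w)"
    by (subst Bochner_Integration.integral_add) (auto simp: F0 circ.prob_space[simplified])
  then show ?thesis by (simp add: cavg_def F_def)
qed


section \<open>Rotation invariance of planar Lebesgue measure\<close>
lemma measurable_Complex [measurable]:
  assumes [measurable]: "f \<in> borel_measurable M" "g \<in> borel_measurable M"
  shows "(\<lambda>x. Complex (f x) (g x)) \<in> borel_measurable M"
  by (simp add: complex_eq_iff Complex_eq)

lemma lborel_complex_eq:
  "(lborel :: complex measure) = distr (lborel \<Otimes>\<^sub>M lborel) borel (\<lambda>(x, y). Complex x y)"
proof (rule lborel_eqI)
  have [measurable]: "(\<lambda>(x, y). Complex x y) \<in> borel_measurable (borel \<Otimes>\<^sub>M borel)"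
    by measurable
  fix l u :: complex
  assume le: "\<And>b. b \<in> Basis \<Longrightarrow> l \<bullet> b \<le> u \<bullet> b"
  have le': "Re l \<le> Re u" "Im l \<le> Im u"
    using le[of 1] le[of \<i>] by (auto simp: Basis_complex_def)
  have "(\<lambda>(x, y). Complex x y) -` box l u = box (Re l) (Re u) \<times> box (Im l) (Im u)"
    by (auto simp: box_def Basis_complex_def)
  then have "emeasure (distr (lborel \<Otimes>\<^sub>M lborel) borel (\<lambda>(x, y). Complex x y)) (box l u)
      = emeasure (lborel \<Otimes>\<^sub>M lborel) (box (Re l) (Re u) \<times> box (Im l) (Im u))"
    by (subst emeasure_distr) (auto simp: space_pair_measure)
  also have "\<dots> = ennreal (Re u - Re l) * ennreal (Im u - Im l)"
    using le' by (subst lborel.emeasure_pair_measure_Times) auto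
  also have "\<dots> = (\<Prod>b\<in>Basis. (u - l) \<bullet> b)"
    using le' by (simp add: Basis_complex_def ennreal_mult)
  finally show "emeasure (distr (lborel \<Otimes>\<^sub>M lborel) borel (\<lambda>(x, y). Complex x y)) (box l u)
      = (\<Prod>b\<in>Basis. (u - l) \<bullet> b)" .
qed simp

lemma nn_integral_lborel_complex:
  fixes f :: "complex \<Rightarrow> ennreal"
  assumes [measurable]: "f \<in> borel_measurable borel"
  shows "(\<integral>\<^sup>+z. f z \<partial>lborel) = (\<integral>\<^sup>+x. \<integral>\<^sup>+y. f (Complex x y) \<partial>lborel \<partial>lborel)"
    and "(\<integral>\<^sup>+z. f z \<partial>lborel) = (\<integral>\<^sup>+y. \<integral>\<^sup>+x. f (Complex x y) \<partial>lborel \<partial>lborel)"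
proof -
  have "(\<integral>\<^sup>+z. f z \<partial>lborel) = (\<integral>\<^sup>+p. f (Complex (fst p) (snd p)) \<partial>(lborel \<Otimes>\<^sub>M lborel))"
    by (subst lborel_complex_eq, subst nn_integral_distr) (auto simp: case_prod_beta)
  then show eq: "(\<integral>\<^sup>+z. f z \<partial>lborel) = (\<integral>\<^sup>+x. \<integral>\<^sup>+y. f (Complex x y) \<partial>lborel \<partial>lborel)"
    by (simp add: lborel.nn_integral_fst[symmetric])
  show "(\<integral>\<^sup>+z. f z \<partial>lborel) = (\<integral>\<^sup>+y. \<integral>\<^sup>+x. f (Complex x y) \<partial>lborel \<partial>lborel)"
    unfolding eq by (rule lborel_pair.Fubini'[symmetric]) measurable
qed

lemma nn_integral_complex_shear:
  fixes f :: "complex \<Rightarrow> ennreal"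
  assumes [measurable]: "f \<in> borel_measurable borel"
  shows "(\<integral>\<^sup>+z. f (Complex (Re z + t * Im z) (Im z)) \<partial>lborel) = (\<integral>\<^sup>+z. f z \<partial>lborel)"
    and "(\<integral>\<^sup>+z. f (Complex (Re z) (Im z + t * Re z)) \<partial>lborel) = (\<integral>\<^sup>+z. f z \<partial>lborel)"
proof -
  have shift: "(\<integral>\<^sup>+x. g (x + c) \<partial>lborel) = (\<integral>\<^sup>+x. g x \<partial>lborel)"
    if [measurable]: "g \<in> borel_measurable borel" for g :: "real \<Rightarrow> ennreal" and c
    using nn_integral_real_affine[of g 1 c] by (simp add: add.commute)
  show "(\<integral>\<^sup>+z. f (Complex (Re z + t * Im z) (Im z)) \<partial>lborel) = (\<integral>\<^sup>+z. f z \<partial>lborel)"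
    using shift[of "\<lambda>x. f (Complex x _)"]
    by (simp add: nn_integral_lborel_complex(2))
  show "(\<integral>\<^sup>+z. f (Complex (Re z) (Im z + t * Re z)) \<partial>lborel) = (\<integral>\<^sup>+z. f z \<partial>lborel)"
    using shift[of "\<lambda>y. f (Complex _ y)"]
    by (simp add: nn_integral_lborel_complex(1))
qed

text \<open>A rotation by an angle other than \<open>\<pi>\<close> is a product of three shears, and shears preserve the measure
  by Fubini.\<close>
lemma nn_integral_complex_rotate:
  fixes f :: "complex \<Rightarrow> ennreal"
  assumes [measurable]: "f \<in> borel_measurable borel" and w: "norm w = 1"
  shows "(\<integral>\<^sup>+z. f (w * z) \<partial>lborel) = (\<integral>\<^sup>+z. f z \<partial>lborel)"
proof -
  have main: "(\<integral>\<^sup>+z. f (w * z) \<partial>lborel) = (\<integral>\<^sup>+z. f z \<partial>lborel)"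
    if [measurable]: "f \<in> borel_measurable borel" and w: "norm w = 1" and "Re w \<noteq> -1" 
    for f :: "complex \<Rightarrow> ennreal" and w
  proof -
    define c s where "c = Re w" and "s = Im w"
    have cs: "c\<^sup>2 + s\<^sup>2 = 1" using w unfolding c_def s_def by (simp add: cmod_def real_sqrt_eq_1_iff)
    have c: "1 + c \<noteq> 0" using that by (simp add: c_def)
    define t where "t = s / (1 + c)"
    have t1: "1 - t * s = c"
      using c cs by (simp add: t_def field_simps power2_eq_square)
    have t2: "- t + c * - t = - s"
    proof -
      have "t * (1 + c) = s" using c by (simp add: t_def)
      then show ?thesis by (simp add: algebra_simps)
    qed
    let ?H = "\<lambda>z. Complex (Re z + (-t) * Im z) (Im z)"
    let ?V = "\<lambda>z. Complex (Re z) (Im z + s * Re z)"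
    have eq: "w * z = ?H (?V (?H z))" for z
    proof -
      have "Re (?H (?V (?H z))) = (1 - t * s) * Re z + (- t + (1 - t * s) * - t) * Im z"
        by (simp add: algebra_simps)
      moreover have "Im (?H (?V (?H z))) = (1 - t * s) * Im z + s * Re z"
        by (simp add: algebra_simps)
      ultimately show ?thesis
        unfolding t1 t2 by (simp add: complex_eq_iff c_def s_def algebra_simps)
    qed
    have "(\<integral>\<^sup>+z. f (w * z) \<partial>lborel) = (\<integral>\<^sup>+z. f (?H (?V (?H z))) \<partial>lborel)"
      by (simp only: eq)
    also have "\<dots> = (\<integral>\<^sup>+z. f (?H (?V z)) \<partial>lborel)"
      by (rule nn_integral_complex_shear(1)[where f="\<lambda>z. f (?H (?V z))"]) measurable
    also have "\<dots> = (\<integral>\<^sup>+z. f (?H z) \<partial>lborel)"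
      by (rule nn_integral_complex_shear(2)[where f="\<lambda>z. f (?H z)"]) measurable
    also have "\<dots> = (\<integral>\<^sup>+z. f z \<partial>lborel)"
      by (rule nn_integral_complex_shear(1)) measurable
    finally show ?thesis .
  qed
  show ?thesis
  proof (cases "Re w = -1")
    case True
    then have "w = \<i> * \<i>"
      using w by (auto simp: complex_eq_iff cmod_def real_sqrt_eq_1_iff)
    then show ?thesis
      using main[of "\<lambda>z. f (\<i> * z)" \<i>] main[of f \<i>] by (simp add: mult.assoc)
  qed (use main w in auto)
qed

lemma integral_complex_rotate:
  fixes f :: "complex \<Rightarrow> real"
  assumes [measurable]: "f \<in> borel_measurable borel" and w: "norm w = 1"
  shows "(\<integral>z. f (w * z) \<partial>lborel) = (\<integral>z. f z \<partial>lborel)"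
proof -
  have "distr lborel borel (\<lambda>z. w * z) = (lborel :: complex measure)"
  proof (rule measure_eqI)
    fix A assume "A \<in> sets (distr lborel borel (\<lambda>z::complex. w * z))"
    then have [measurable]: "A \<in> sets borel" by simp
    have "emeasure (distr lborel borel (\<lambda>z. w * z)) A = (\<integral>\<^sup>+z. indicator A z \<partial>distr lborel borel (\<lambda>z. w * z))"
      by simp
    also have "\<dots> = (\<integral>\<^sup>+z. indicator A (w * z) \<partial>lborel)"
      by (subst nn_integral_distr) auto
    also have "\<dots> = emeasure lborel A"
      using w by (subst nn_integral_complex_rotate) auto
    finally show "emeasure (distr lborel borel (\<lambda>z. w * z)) A = emeasure lborel A" .
  qed simp
  then show ?thesis
    using integral_distr[of "\<lambda>z. w * z" lborel borel f] by simp
qed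

lemma integral_complex_translate:
  fixes f :: "complex \<Rightarrow> real"
  assumes [measurable]: "f \<in> borel_measurable borel"
  shows "(\<integral>z. f (z + a) \<partial>lborel) = (\<integral>z. f z \<partial>lborel)"
  using integral_distr[of "(+) a" lborel borel f] by (simp add: lborel_distr_plus add.commute)


section \<open>A mollifier made from the logarithm\<close>

text \<open>The logarithmic kernel, truncated from below at \<open>ln \<delta>\<close> to make it continuous and locally bounded.\<close>
definition lnt :: "real \<Rightarrow> complex \<Rightarrow> real" where
  "lnt \<delta> \<zeta> = ln (max (norm \<zeta>) \<delta>)"

text \<open>The mollifier: how far the truncated logarithm falls below its own mean over circles of radius \<open>\<delta>\<close>.
  It is nonnegative, radial, and vanishes outside the disc of radius \<open>2 \<delta>\<close>.  Its mass is left
  unnormalised; only its positivity matters.\<close>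
definition ker :: "real \<Rightarrow> complex \<Rightarrow> real" where
  "ker \<delta> \<zeta> = cavg (lnt \<delta>) \<zeta> (- \<delta>) - lnt \<delta> \<zeta>"

lemma measurable_cis [measurable]: "cis \<in> borel_measurable borel"
  by (rule borel_measurable_continuous_onI) (auto intro!: continuous_intros)

lemma measurable_lnt [measurable]: "lnt \<delta> \<in> borel_measurable borel"
  unfolding lnt_def[abs_def] by measurable

lemma lnt_bound:
  assumes "\<delta> > 0" "norm \<zeta> \<le> B"
  shows "\<bar>lnt \<delta> \<zeta>\<bar> \<le> \<bar>ln \<delta>\<bar> + \<bar>ln (max B \<delta>)\<bar>"
proof -
  have "ln \<delta> \<le> lnt \<delta> \<zeta>" "lnt \<delta> \<zeta> \<le> ln (max B \<delta>)"
    unfolding lnt_def using assms by (auto intro!: ln_mono)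
  then show ?thesis by linarith
qed

lemma lnt_lipschitz:
  assumes "\<delta> > 0"
  shows "\<bar>lnt \<delta> a - lnt \<delta> b\<bar> \<le> norm (a - b) / \<delta>"
proof -
  have *: "ln x - ln y \<le> \<bar>x - y\<bar> / \<delta>" if "x \<ge> \<delta>" "y \<ge> \<delta>" for x y :: real
  proof -
    have "ln x - ln y \<le> (x - y) / y" using that assms by (intro ln_diff_le) auto
    also have "\<dots> \<le> \<bar>x - y\<bar> / y" using that assms by (intro divide_right_mono) auto
    also have "\<dots> \<le> \<bar>x - y\<bar> / \<delta>" using that assms by (intro divide_left_mono) auto
    finally show ?thesis .
  qed
  have "\<bar>lnt \<delta> a - lnt \<delta> b\<bar> \<le> \<bar>max (norm a) \<delta> - max (norm b) \<delta>\<bar> / \<delta>"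
    unfolding lnt_def using *[of "max (norm a) \<delta>" "max (norm b) \<delta>"] *[of "max (norm b) \<delta>" "max (norm a) \<delta>"]
    by (simp add: abs_le_iff abs_minus_commute)
  also have "\<dots> \<le> norm (a - b) / \<delta>"
  proof (rule divide_right_mono)
    show "\<bar>max (norm a) \<delta> - max (norm b) \<delta>\<bar> \<le> norm (a - b)"
      using norm_triangle_ineq3[of a b] by (auto simp: max_def)
  qed (use assms in auto)
  finally show ?thesis .
qed

lemma circ_integrable_lnt:
  assumes "\<delta> > 0"
  shows "integrable circ (\<lambda>s. lnt \<delta> (w + of_real h * cis s))"
proof (rule circ_integrable)
  show "\<bar>lnt \<delta> (w + of_real h * cis s)\<bar> \<le> \<bar>ln \<delta>\<bar> + \<bar>ln (max (norm w + \<bar>h\<bar>) \<delta>)\<bar>" for s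
    using assms norm_triangle_ineq[of w "of_real h * cis s"] by (intro lnt_bound) (auto simp: norm_mult)
qed measurable

lemma measurable_cavg [measurable]:
  assumes [measurable]: "f \<in> borel_measurable borel"
  shows "(\<lambda>z. cavg f z h) \<in> borel_measurable borel"
  unfolding cavg_def by measurable

lemma measurable_ker [measurable]: "ker \<delta> \<in> borel_measurable borel"
  unfolding ker_def[abs_def] by measurable

lemma ker_lipschitz:
  assumes "\<delta> > 0"
  shows "\<bar>ker \<delta> a - ker \<delta> b\<bar> \<le> 2 * norm (a - b) / \<delta>"
proof -
  have "\<bar>cavg (lnt \<delta>) a (-\<delta>) - cavg (lnt \<delta>) b (-\<delta>)\<bar>
      = \<bar>\<integral>s. lnt \<delta> (a + of_real (-\<delta>) * cis s) - lnt \<delta> (b + of_real (-\<delta>) * cis s) \<partial>circ\<bar>"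
    unfolding cavg_def using assms
    by (subst Bochner_Integration.integral_diff) (intro circ_integrable_lnt assms refl)+
  also have "\<dots> \<le> (\<integral>s. \<bar>lnt \<delta> (a + of_real (-\<delta>) * cis s) - lnt \<delta> (b + of_real (-\<delta>) * cis s)\<bar> \<partial>circ)"
    by (rule integral_abs_bound)
  also have "\<dots> \<le> norm (a - b) / \<delta>"
  proof (rule circ.integral_le_const)
    show "AE s in circ. \<bar>lnt \<delta> (a + of_real (-\<delta>) * cis s) - lnt \<delta> (b + of_real (-\<delta>) * cis s)\<bar> \<le> norm (a - b) / \<delta>"
    proof (rule AE_I2)
      show "\<bar>lnt \<delta> (a + of_real (-\<delta>) * cis s) - lnt \<delta> (b + of_real (-\<delta>) * cis s)\<bar> \<le> norm (a - b) / \<delta>" for s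
        using lnt_lipschitz[OF assms, of "a + of_real (-\<delta>) * cis s" "b + of_real (-\<delta>) * cis s"] by simp
    qed
  qed (intro integrable_abs Bochner_Integration.integrable_diff circ_integrable_lnt assms)
  finally have "\<bar>cavg (lnt \<delta>) a (-\<delta>) - cavg (lnt \<delta>) b (-\<delta>)\<bar> \<le> norm (a - b) / \<delta>" .
  then show ?thesis
    unfolding ker_def using lnt_lipschitz[OF assms, of a b] by (simp add: field_simps abs_le_iff)
qed

lemma cavg_lnt_eq:
  assumes "\<delta> > 0" "norm w \<ge> \<bar>h\<bar> + \<delta>"
  shows "cavg (lnt \<delta>) w h = ln (norm w)"
proof -
  have "lnt \<delta> (w + of_real h * cis s) = ln (norm (w + of_real h * cis s))" for s
  proof -
    have "norm w - \<bar>h\<bar> \<le> norm (w + of_real h * cis s)"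
      using norm_diff_ineq[of w "of_real h * cis s"] by (simp add: norm_mult)
    then have "max (norm (w + of_real h * cis s)) \<delta> = norm (w + of_real h * cis s)"
      using assms by (intro max_absorb1) linarith
    then show ?thesis by (simp add: lnt_def)
  qed
  then have "cavg (lnt \<delta>) w h = cavg (\<lambda>\<zeta>. ln (norm \<zeta>)) w h" by (simp add: cavg_def)
  then show ?thesis using assms by (simp add: cavg_ln_norm)
qed

lemma ker_eq_0:
  assumes "\<delta> > 0" "norm \<zeta> \<ge> 2 * \<delta>"
  shows "ker \<delta> \<zeta> = 0"
  using assms unfolding ker_def by (subst cavg_lnt_eq) (auto simp: lnt_def max_def)

text \<open>The radius of averaging does not exceed the truncation level: where the truncation is inactive at \<open>\<zeta>\<close>,
  the circle around \<open>\<zeta>\<close> does not enclose the origin.\<close>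
lemma ker_nonneg:
  assumes "\<delta> > 0"
  shows "ker \<delta> \<zeta> \<ge> 0"
proof (cases "norm \<zeta> \<le> \<delta>")
  case True
  then have "lnt \<delta> \<zeta> = ln \<delta>" by (simp add: lnt_def max_def)
  also have "\<dots> \<le> cavg (lnt \<delta>) \<zeta> (- \<delta>)"
    unfolding cavg_def using assms
    by (intro circ.integral_ge_const circ_integrable_lnt) (auto simp: lnt_def)
  finally show ?thesis by (simp add: ker_def)
next
  case False
  have n: "norm \<zeta> - \<delta> \<le> norm (\<zeta> + of_real (- \<delta>) * cis s)" "norm (\<zeta> + of_real (- \<delta>) * cis s) \<le> norm \<zeta> + \<delta>" for s
    using norm_diff_ineq[of \<zeta> "of_real (- \<delta>) * cis s"] norm_triangle_ineq[of \<zeta> "of_real (- \<delta>) * cis s"] assms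
    by (simp_all add: norm_mult)
  have "lnt \<delta> \<zeta> = ln (norm \<zeta>)" using False by (simp add: lnt_def max_def)
  also have "\<dots> = cavg (\<lambda>\<zeta>. ln (norm \<zeta>)) \<zeta> (- \<delta>)" using False assms by (simp add: cavg_ln_norm)
  also have "\<dots> \<le> cavg (lnt \<delta>) \<zeta> (- \<delta>)"
    unfolding cavg_def
  proof (rule integral_mono)
    show "integrable circ (\<lambda>s. ln (norm (\<zeta> + of_real (- \<delta>) * cis s)))"
    proof (rule circ_integrable)
      show "\<bar>ln (norm (\<zeta> + of_real (- \<delta>) * cis s))\<bar> \<le> \<bar>ln (norm \<zeta> - \<delta>)\<bar> + \<bar>ln (norm \<zeta> + \<delta>)\<bar>" for s
      proof -
        have "ln (norm \<zeta> - \<delta>) \<le> ln (norm (\<zeta> + of_real (- \<delta>) * cis s))"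
          "ln (norm (\<zeta> + of_real (- \<delta>) * cis s)) \<le> ln (norm \<zeta> + \<delta>)"
          using n[of s] False assms by (auto intro!: ln_mono simp del: of_real_minus)
        then show ?thesis by linarith
      qed
    qed measurable
    show "integrable circ (\<lambda>s. lnt \<delta> (\<zeta> + of_real (- \<delta>) * cis s))"
      using assms by (rule circ_integrable_lnt)
    show "ln (norm (\<zeta> + of_real (- \<delta>) * cis s)) \<le> lnt \<delta> (\<zeta> + of_real (- \<delta>) * cis s)" for s
      unfolding lnt_def using n(1)[of s] False by (intro ln_mono) (auto simp del: of_real_minus)
  qed
  finally show ?thesis by (simp add: ker_def)
qed

lemma cavg_rotate:
  assumes [measurable]: "f \<in> borel_measurable borel" and B: "\<And>z. norm z \<le> norm \<zeta> + \<bar>h\<bar> \<Longrightarrow> \<bar>f z\<bar> \<le> B"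
    and w: "norm w = 1"
  shows "cavg f (w * \<zeta>) h = (\<integral>s. f (w * (\<zeta> + of_real h * cis s)) \<partial>circ)"
proof -
  have "w \<noteq> 0" using w by auto
  then have wc: "w = cis (Arg2pi w)" using w Arg2pi_eq[of w] by (simp add: cis_conv_exp)
  have "(\<integral>s. f (w * \<zeta> + of_real h * cis (s + Arg2pi w)) \<partial>circ) = (\<integral>s. f (w * \<zeta> + of_real h * cis s) \<partial>circ)"
  proof (rule circ_integral_shift)
    show "\<bar>f (w * \<zeta> + of_real h * cis s)\<bar> \<le> B" for s
      using norm_triangle_ineq[of "w * \<zeta>" "of_real h * cis s"] w by (intro B) (auto simp: norm_mult)
    show "f (w * \<zeta> + of_real h * cis (s + 2 * pi)) = f (w * \<zeta> + of_real h * cis s)" for s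
      by (simp add: cis.ctr)
  qed (auto simp: Arg2pi_ge_0 Arg2pi_lt_2pi less_imp_le)
  moreover have "w * \<zeta> + of_real h * cis (s + Arg2pi w) = w * (\<zeta> + of_real h * cis s)" for s
    by (subst (1 3) wc) (simp add: cis_mult algebra_simps flip: cis_mult)
  ultimately show ?thesis by (simp add: cavg_def)
qed

lemma ker_rotate:
  assumes "\<delta> > 0" "norm w = 1"
  shows "ker \<delta> (w * \<zeta>) = ker \<delta> \<zeta>"
proof -
  have "cavg (lnt \<delta>) (w * \<zeta>) (-\<delta>) = cavg (lnt \<delta>) \<zeta> (-\<delta>)"
    using assms(2)
    by (subst cavg_rotate[OF measurable_lnt lnt_bound[OF assms(1)] assms(2)])
       (simp_all add: cavg_def lnt_def norm_mult del: of_real_minus)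
  then show ?thesis using assms(2) by (simp add: ker_def lnt_def norm_mult)
qed

text \<open>At the point \<open>\<delta>\<close> the truncated logarithm has its minimal value, and on the right half of the circle
  around it the value is larger by a definite amount.\<close>
lemma ker_delta_pos:
  assumes "\<delta> > 0"
  shows "ker \<delta> (of_real \<delta>) > 0"
proof -
  define A where "A = {pi/2..3*pi/2}"
  have n: "norm (of_real \<delta> + of_real (-\<delta>) * cis s) \<ge> sqrt 2 * \<delta>" if "s \<in> A" for s
  proof -
    have "0 \<le> cos (s - pi)" using that by (intro cos_ge_zero) (auto simp: A_def)
    then have cs: "cos s \<le> 0" by (simp add: cos_diff)
    have "(norm (1 - cis s))\<^sup>2 = (1 - cos s)\<^sup>2 + (sin s)\<^sup>2" by (simp add: cmod_power2)
    also have "\<dots> = 2 - 2 * cos s" using sin_cos_squared_add[of s] by (simp add: power2_eq_square algebra_simps)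
    finally have "sqrt 2 \<le> norm (1 - cis s)" using cs by (intro real_le_lsqrt) auto
    moreover have "of_real \<delta> + of_real (-\<delta>) * cis s = of_real \<delta> * (1 - cis s)" by (simp add: algebra_simps)
    ultimately show ?thesis using assms by (simp add: norm_mult)
  qed
  have "0 < ln (sqrt 2) * measure circ A"
  proof -
    have "measure circ A > 0" by (simp add: circ_def A_def)
    then show ?thesis by simp
  qed
  also have "\<dots> = (\<integral>s. ln (sqrt 2) * indicator A s \<partial>circ)" by (simp add: A_def)
  also have "\<dots> \<le> (\<integral>s. lnt \<delta> (of_real \<delta> + of_real (-\<delta>) * cis s) - ln \<delta> \<partial>circ)"
  proof (rule integral_mono)
    fix s
    show "ln (sqrt 2) * indicator A s \<le> lnt \<delta> (of_real \<delta> + of_real (-\<delta>) * cis s) - ln \<delta>"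
    proof (cases "s \<in> A")
      case True
      have "ln (sqrt 2) + ln \<delta> = ln (sqrt 2 * \<delta>)" using assms by (simp add: ln_mult)
      also have "\<dots> \<le> lnt \<delta> (of_real \<delta> + of_real (-\<delta>) * cis s)"
        unfolding lnt_def using n[OF True] assms by (intro ln_mono) auto
      finally show ?thesis using True by simp
    next
      case False
      then show ?thesis using assms by (simp add: lnt_def)
    qed
  next
    show "integrable circ (\<lambda>s. ln (sqrt 2) * indicator A s)"
      by (rule circ_integrable[where B="ln (sqrt 2)"]) (auto simp: A_def indicator_def)
  qed (use assms in \<open>auto intro!: circ_integrable_lnt simp del: of_real_minus\<close>)
  also have "\<dots> = ker \<delta> (of_real \<delta>)"
  proof -
    have "lnt \<delta> (of_real \<delta>) = ln \<delta>" using assms by (simp add: lnt_def)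
    then show ?thesis
      unfolding ker_def cavg_def using assms circ.prob_space
      by (subst Bochner_Integration.integral_diff) (auto intro!: circ_integrable_lnt simp del: of_real_minus)
  qed
  finally show ?thesis .
qed

lemma integrable_compact_support:
  fixes f :: "complex \<Rightarrow> real"
  assumes "f \<in> borel_measurable borel" "\<And>z. \<bar>f z\<bar> \<le> B" "\<And>z. norm z > \<rho> \<Longrightarrow> f z = 0"
  shows "integrable lborel f"
proof (rule integrableI_bounded_set[where A="cball 0 \<rho>" and B=B])
  show "emeasure lborel (cball 0 \<rho> :: complex set) < \<infinity>"
    by (rule emeasure_bounded_finite) simp
qed (use assms in \<open>auto simp: not_le\<close>)

lemma integrable_pair_compact_support:
  fixes f :: "'a \<times> complex \<Rightarrow> real"
  assumes "finite_measure T" and [measurable]: "f \<in> borel_measurable (T \<Otimes>\<^sub>M borel)"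
    and B: "\<And>t w. t \<in> space T \<Longrightarrow> \<bar>f (t, w)\<bar> \<le> B" and 0: "\<And>t w. t \<in> space T \<Longrightarrow> norm w > \<rho> \<Longrightarrow> f (t, w) = 0"
  shows "integrable (T \<Otimes>\<^sub>M lborel) f"
proof (rule integrableI_bounded_set[where A="space T \<times> cball 0 \<rho>" and B=B])
  interpret finite_measure T by fact
  show "emeasure (T \<Otimes>\<^sub>M lborel) (space T \<times> cball (0::complex) \<rho>) < \<infinity>"
  proof (subst lborel.emeasure_pair_measure_Times)
    have "emeasure T (space T) < top" by (metis emeasure_finite infinity_ennreal_def less_top)
    then show "emeasure T (space T) * emeasure lborel (cball (0::complex) \<rho>) < \<infinity>"
      using emeasure_bounded_finite[of "cball (0::complex) \<rho>"] by (simp add: ennreal_mult_less_top)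
  qed auto
  show "AE p in T \<Otimes>\<^sub>M lborel. p \<notin> space T \<times> cball 0 \<rho> \<longrightarrow> f p = 0"
  proof (rule AE_I2)
    fix p :: "'a \<times> complex" assume "p \<in> space (T \<Otimes>\<^sub>M lborel)"
    then obtain t w where "p = (t, w)" "t \<in> space T" by (auto simp: space_pair_measure)
    then show "p \<notin> space T \<times> cball 0 \<rho> \<longrightarrow> f p = 0" using 0[of t w] by auto
  qed
  show "AE p in T \<Otimes>\<^sub>M lborel. p \<in> space T \<times> cball 0 \<rho> \<longrightarrow> norm (f p) \<le> B"
    by (rule AE_I2) (use B in auto)
qed auto

lemma ker_bound:
  assumes "\<delta> > 0"
  shows "\<bar>ker \<delta> \<zeta>\<bar> \<le> 8"
proof (cases "norm \<zeta> \<ge> 2 * \<delta>")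
  case False
  have "\<bar>ker \<delta> \<zeta> - ker \<delta> (of_real (2 * \<delta>))\<bar> \<le> 2 * norm (\<zeta> - of_real (2 * \<delta>)) / \<delta>"
    using assms by (rule ker_lipschitz)
  also have "ker \<delta> (of_real (2 * \<delta>)) = 0" using assms by (intro ker_eq_0) auto
  also have "norm (\<zeta> - of_real (2 * \<delta>)) \<le> 4 * \<delta>"
    using norm_triangle_ineq4[of \<zeta> "of_real (2 * \<delta>)"] False assms by simp
  finally show ?thesis using assms by (simp add: divide_simps)
qed (use assms ker_eq_0 in auto)

text \<open>The total mass of the mollifier.\<close>
definition kmass :: "real \<Rightarrow> real" where
  "kmass \<delta> = (\<integral>\<zeta>. ker \<delta> \<zeta> \<partial>lborel)"

lemma integrable_ker:
  assumes "\<delta> > 0"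
  shows "integrable lborel (ker \<delta>)"
  using assms by (intro integrable_compact_support[where B=8 and \<rho>="2*\<delta>"]) (auto simp: ker_bound ker_eq_0)

lemma kmass_pos:
  assumes "\<delta> > 0"
  shows "kmass \<delta> > 0"
proof -
  define c where "c = ker \<delta> (of_real \<delta>)"
  define S where "S = ball (complex_of_real \<delta>) (\<delta> * c / 4)"
  have c: "c > 0" using ker_delta_pos[OF assms] by (simp add: c_def)
  have "measure lborel S > 0" 
    unfolding S_def using c assms by (intro content_ball_pos) auto
  then have "0 < c / 2 * measure lborel S" using c by simp
  also have "\<dots> = (\<integral>\<zeta>. c / 2 * indicator S \<zeta> \<partial>lborel)" by (simp add: S_def)
  also have "\<dots> \<le> kmass \<delta>"
    unfolding kmass_def
  proof (rule integral_mono)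
    show "c / 2 * indicator S \<zeta> \<le> ker \<delta> \<zeta>" for \<zeta>
    proof (cases "\<zeta> \<in> S")
      case True
      then have "norm (\<zeta> - of_real \<delta>) < \<delta> * c / 4" by (simp add: S_def dist_norm norm_minus_commute)
      then have "2 * norm (\<zeta> - of_real \<delta>) / \<delta> < c / 2" using assms by (simp add: field_simps)
      then show ?thesis using ker_lipschitz[OF assms, of \<zeta> "of_real \<delta>"] True unfolding c_def by simp
    qed (use ker_nonneg[OF assms] in auto)
    show "integrable lborel (\<lambda>\<zeta>. c / 2 * indicator S \<zeta>)"
      by (intro integrable_mult_right integrable_real_indicator) (use emeasure_bounded_finite[of S] in \<open>auto simp: S_def\<close>)
  qed (use integrable_ker[OF assms] in auto)
  finally show ?thesis .
qed

text \<open>Unnormalised mollification of \<open>v\<close>.\<close>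
definition moll :: "(complex \<Rightarrow> real) \<Rightarrow> real \<Rightarrow> complex \<Rightarrow> real" where
  "moll v \<delta> y = (\<integral>\<zeta>. v (y + \<zeta>) * ker \<delta> \<zeta> \<partial>lborel)"

lemma integrable_moll:
  assumes "\<delta> > 0" and [measurable]: "v \<in> borel_measurable borel" and N: "\<And>z. \<bar>v z\<bar> \<le> N"
  shows "integrable lborel (\<lambda>\<zeta>. v (y + \<zeta>) * ker \<delta> \<zeta>)"
proof (rule integrable_compact_support[where B="N*8" and \<rho>="2*\<delta>"])
  have "N \<ge> 0" using N[of 0] by linarith
  then show "\<bar>v (y + \<zeta>) * ker \<delta> \<zeta>\<bar> \<le> N * 8" for \<zeta>
    unfolding abs_mult using N ker_bound[OF assms(1)] by (intro mult_mono) auto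
qed (use assms(1) in \<open>auto simp: ker_eq_0\<close>)

lemma moll_lower:
  assumes "\<delta> > 0" "v \<in> borel_measurable borel" "\<And>z. \<bar>v z\<bar> \<le> N"
    and c: "\<And>z. dist y z < 2 * \<delta> \<Longrightarrow> c \<le> v z"
  shows "c * kmass \<delta> \<le> moll v \<delta> y"
proof -
  have "c * kmass \<delta> = (\<integral>\<zeta>. c * ker \<delta> \<zeta> \<partial>lborel)" by (simp add: kmass_def)
  also have "\<dots> \<le> moll v \<delta> y"
    unfolding moll_def
  proof (rule integral_mono)
    show "c * ker \<delta> \<zeta> \<le> v (y + \<zeta>) * ker \<delta> \<zeta>" for \<zeta>
      using c[of "y + \<zeta>"] ker_nonneg[OF assms(1), of \<zeta>] ker_eq_0[OF assms(1), of \<zeta>]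
      by (cases "norm \<zeta> < 2 * \<delta>") (auto simp: dist_norm intro: mult_right_mono)
  qed (use integrable_ker[OF assms(1)] integrable_moll[OF assms(1-3)] in auto)
  finally show ?thesis .
qed

text \<open>Superharmonic functions decrease under mollification.  Averaging over rotations of the plane, which
  leave the radial mollifier unchanged, turns the integral into a mixture of means over circles around \<open>y\<close>.\<close>
lemma moll_upper:
  assumes \<delta>: "\<delta> > 0" and [measurable]: "v \<in> borel_measurable borel" and N: "\<And>z. \<bar>v z\<bar> \<le> N"
    and sm: "\<And>h. 0 < h \<Longrightarrow> h < 2 * \<delta> \<Longrightarrow> cavg v y h \<le> v y"
  shows "moll v \<delta> y \<le> v y * kmass \<delta>"
proof -
  interpret P: pair_sigma_finite circ "lborel :: complex measure" ..
  have N0: "N \<ge> 0" using N[of 0] by linarith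
  have "moll v \<delta> y = (\<integral>s. moll v \<delta> y \<partial>circ)" using circ.prob_space by simp
  also have "\<dots> = (\<integral>s. (\<integral>\<zeta>. v (y + cis s * \<zeta>) * ker \<delta> \<zeta> \<partial>lborel) \<partial>circ)"
  proof -
    have "moll v \<delta> y = (\<integral>\<zeta>. v (y + cis s * \<zeta>) * ker \<delta> \<zeta> \<partial>lborel)" for s
      unfolding moll_def
      by (subst integral_complex_rotate[where w="cis s", symmetric]) (auto simp: ker_rotate[OF \<delta>])
    then show ?thesis by (intro Bochner_Integration.integral_cong) auto
  qed
  also have "\<dots> = (\<integral>\<zeta>. (\<integral>s. v (y + cis s * \<zeta>) * ker \<delta> \<zeta> \<partial>circ) \<partial>lborel)"
  proof (rule P.Fubini_integral[symmetric])
    show "integrable (circ \<Otimes>\<^sub>M lborel) (\<lambda>(s, \<zeta>). v (y + cis s * \<zeta>) * ker \<delta> \<zeta>)"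
    proof (rule integrable_pair_compact_support[where B="N*8" and \<rho>="2*\<delta>"])
      show "\<bar>case (s, \<zeta>) of (s, \<zeta>) \<Rightarrow> v (y + cis s * \<zeta>) * ker \<delta> \<zeta>\<bar> \<le> N * 8" for s \<zeta>
        using N N0 ker_bound[OF \<delta>] by (auto simp: abs_mult intro!: mult_mono)
    qed (auto simp: ker_eq_0[OF \<delta>] circ.finite_measure_axioms)
  qed
  also have "\<dots> \<le> (\<integral>\<zeta>. v y * ker \<delta> \<zeta> \<partial>lborel)"
  proof (rule integral_mono)
    fix \<zeta>
    have "(\<integral>s. v (y + cis s * \<zeta>) \<partial>circ) \<le> v y" if "norm \<zeta> < 2 * \<delta>"
    proof (cases "\<zeta> = 0")
      case True
      then show ?thesis using circ.prob_space by simp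
    next
      case False
      have "(\<integral>s. v (y + cis s * \<zeta>) \<partial>circ) = cavg (\<lambda>z. v (y + z)) (\<zeta> / of_real (norm \<zeta>) * 0) (norm \<zeta>)"
        using False N
        by (subst cavg_rotate[where B=N]) (auto simp: norm_divide mult.commute)
      also have "\<dots> = cavg v y (norm \<zeta>)" by (simp add: cavg_def)
      finally show ?thesis using sm[of "norm \<zeta>"] that False by simp
    qed
    then show "(\<integral>s. v (y + cis s * \<zeta>) * ker \<delta> \<zeta> \<partial>circ) \<le> v y * ker \<delta> \<zeta>"
      using ker_nonneg[OF \<delta>, of \<zeta>] ker_eq_0[OF \<delta>, of \<zeta>]
      by (cases "norm \<zeta> < 2 * \<delta>") (auto intro: mult_right_mono)
  next
    show "integrable lborel (\<lambda>\<zeta>. \<integral>s. v (y + cis s * \<zeta>) * ker \<delta> \<zeta> \<partial>circ)"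
    proof (rule integrable_compact_support[where B="N*8" and \<rho>="2*\<delta>"])
      fix \<zeta>
      have i: "integrable circ (\<lambda>s. v (y + cis s * \<zeta>) * ker \<delta> \<zeta>)"
        using N N0 ker_bound[OF \<delta>] by (intro circ_integrable[where B="N*8"]) (auto simp: abs_mult intro!: mult_mono)
      have "\<bar>\<integral>s. v (y + cis s * \<zeta>) * ker \<delta> \<zeta> \<partial>circ\<bar> \<le> (\<integral>s. \<bar>v (y + cis s * \<zeta>) * ker \<delta> \<zeta>\<bar> \<partial>circ)"
        by (rule integral_abs_bound)
      also have "\<dots> \<le> N * 8"
        using i N N0 ker_bound[OF \<delta>] by (intro circ.integral_le_const) (auto simp: abs_mult intro!: mult_mono)
      finally show "\<bar>\<integral>s. v (y + cis s * \<zeta>) * ker \<delta> \<zeta> \<partial>circ\<bar> \<le> N * 8" .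
    qed (auto simp: ker_eq_0[OF \<delta>])
  qed (use integrable_ker[OF \<delta>] in auto)
  also have "\<dots> = v y * kmass \<delta>" by (simp add: kmass_def)
  finally show ?thesis .
qed


section \<open>Domination of superharmonic functions by potentials\<close>

text \<open>The truncated logarithmic potential of the image of the measure \<open>T\<close> under \<open>y\<close>.  Keeping the
  parametrisation \<open>y\<close> covers curves such as \<open>t \<mapsto> z t\<close> without passing to image measures.\<close>
definition logpot :: "'a measure \<Rightarrow> ('a \<Rightarrow> complex) \<Rightarrow> real \<Rightarrow> complex \<Rightarrow> real" where
  "logpot T y \<delta> w = (\<integral>t. lnt \<delta> (w - y t) \<partial>T)"

text \<open>The mollification of the image of the measure \<open>T\<close> under \<open>y\<close>, as a function on the plane.\<close>
definition kerpot :: "'a measure \<Rightarrow> ('a \<Rightarrow> complex) \<Rightarrow> real \<Rightarrow> complex \<Rightarrow> real" where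
  "kerpot T y \<delta> w = (\<integral>t. ker \<delta> (w - y t) \<partial>T)"

context
  fixes T :: "'a measure" and y :: "'a \<Rightarrow> complex" and \<delta> \<rho> :: real
  assumes fin: "finite_measure T" and y [measurable]: "y \<in> borel_measurable T"
    and y_bd: "\<And>t. t \<in> space T \<Longrightarrow> norm (y t) \<le> \<rho>" and \<delta>: "\<delta> > 0"
begin

interpretation finite_measure T by (fact fin)

lemma measurable_logpot: "logpot T y \<delta> \<in> borel_measurable borel"
  unfolding logpot_def[abs_def] by measurable

lemma measurable_kerpot: "kerpot T y \<delta> \<in> borel_measurable borel"
  unfolding kerpot_def[abs_def] by measurable

lemma lnt_diff_bound:
  assumes "t \<in> space T" "norm w \<le> B"
  shows "\<bar>lnt \<delta> (w - y t)\<bar> \<le> \<bar>ln \<delta>\<bar> + \<bar>ln (max (B + \<rho>) \<delta>)\<bar>"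
  using norm_triangle_ineq4[of w "y t"] y_bd[OF assms(1)] assms(2) \<delta> by (intro lnt_bound) auto

lemma integrable_lnt_diff: "integrable T (\<lambda>t. lnt \<delta> (w - y t))"
  using lnt_diff_bound[OF _ order_refl, of _ w]
  by (intro integrable_const_bound[where B="\<bar>ln \<delta>\<bar> + \<bar>ln (max (norm w + \<rho>) \<delta>)\<bar>"]) (auto intro!: AE_I2)

lemma integrable_ker_diff: "integrable T (\<lambda>t. ker \<delta> (w - y t))"
  using ker_bound[OF \<delta>] by (intro integrable_const_bound[where B=8]) (auto intro!: AE_I2)

lemma abs_integral_le:
  assumes "integrable T f" "\<And>t. t \<in> space T \<Longrightarrow> \<bar>f t\<bar> \<le> C"
  shows "\<bar>\<integral>t. f t \<partial>T\<bar> \<le> C * measure T (space T)"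
proof -
  have "\<bar>\<integral>t. f t \<partial>T\<bar> \<le> (\<integral>t. \<bar>f t\<bar> \<partial>T)" by (rule integral_abs_bound)
  also have "\<dots> \<le> (\<integral>t. C \<partial>T)" using assms by (intro integral_mono) auto
  finally show ?thesis by (simp add: mult.commute)
qed

lemma logpot_bound:
  assumes "norm w \<le> B"
  shows "\<bar>logpot T y \<delta> w\<bar> \<le> (\<bar>ln \<delta>\<bar> + \<bar>ln (max (B + \<rho>) \<delta>)\<bar>) * measure T (space T)"
  unfolding logpot_def using integrable_lnt_diff lnt_diff_bound[OF _ assms] by (rule abs_integral_le)

lemma kerpot_nonneg: "kerpot T y \<delta> w \<ge> 0"
  unfolding kerpot_def using ker_nonneg[OF \<delta>] by (intro Bochner_Integration.integral_nonneg) auto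

lemma kerpot_bound: "\<bar>kerpot T y \<delta> w\<bar> \<le> 8 * measure T (space T)"
  unfolding kerpot_def using integrable_ker_diff ker_bound[OF \<delta>] by (rule abs_integral_le)

lemma ker_diff_eq_0: "t \<in> space T \<Longrightarrow> norm w \<ge> \<rho> + 2 * \<delta> \<Longrightarrow> ker \<delta> (w - y t) = 0"
  using norm_triangle_ineq2[of w "y t"] y_bd[of t] by (intro ker_eq_0 \<delta>) auto

lemma kerpot_eq_0: "norm w \<ge> \<rho> + 2 * \<delta> \<Longrightarrow> kerpot T y \<delta> w = 0"
  unfolding kerpot_def by (subst Bochner_Integration.integral_cong[where g="\<lambda>_. 0"]) (auto simp: ker_diff_eq_0)

lemma cavg_logpot: "cavg (logpot T y \<delta>) w (- \<delta>) = logpot T y \<delta> w + kerpot T y \<delta> w"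
proof -
  interpret P: pair_sigma_finite circ T ..
  interpret PF: finite_measure "circ \<Otimes>\<^sub>M T"
    by (intro finite_measure_pair_measure circ.finite_measure_axioms fin)
  have bd: "\<bar>lnt \<delta> (w + of_real (- \<delta>) * cis s - y t)\<bar> \<le> \<bar>ln \<delta>\<bar> + \<bar>ln (max (norm w + \<delta> + \<rho>) \<delta>)\<bar>"
    if "t \<in> space T" for s t
    using norm_triangle_ineq[of w "of_real (-\<delta>) * cis s"] \<delta> that
    by (intro lnt_diff_bound) (auto simp: norm_mult simp del: of_real_minus)
  have "cavg (logpot T y \<delta>) w (- \<delta>) = (\<integral>s. \<integral>t. lnt \<delta> (w + of_real (- \<delta>) * cis s - y t) \<partial>T \<partial>circ)"
    by (simp add: cavg_def logpot_def)
  also have "\<dots> = (\<integral>t. \<integral>s. lnt \<delta> (w + of_real (- \<delta>) * cis s - y t) \<partial>circ \<partial>T)"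
  proof (rule P.Fubini_integral[symmetric])
    show "integrable (circ \<Otimes>\<^sub>M T) (\<lambda>(s, t). lnt \<delta> (w + of_real (- \<delta>) * cis s - y t))"
      by (rule PF.integrable_const_bound[where B="\<bar>ln \<delta>\<bar> + \<bar>ln (max (norm w + \<delta> + \<rho>) \<delta>)\<bar>"])
         (use bd in \<open>auto intro!: AE_I2 simp: space_pair_measure simp del: of_real_minus\<close>)
  qed
  also have "\<dots> = (\<integral>t. lnt \<delta> (w - y t) + ker \<delta> (w - y t) \<partial>T)"
    by (simp add: ker_def cavg_def algebra_simps)
  also have "\<dots> = logpot T y \<delta> w + kerpot T y \<delta> w"
    unfolding logpot_def kerpot_def
    by (intro Bochner_Integration.integral_add integrable_lnt_diff integrable_ker_diff)
  finally show ?thesis .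
qed

lemma integral_kerpot:
  assumes [measurable]: "v \<in> borel_measurable borel" and N: "\<And>z. \<bar>v z\<bar> \<le> N"
  shows "(\<integral>w. v w * kerpot T y \<delta> w \<partial>lborel) = (\<integral>t. moll v \<delta> (y t) \<partial>T)"
proof -
  interpret P: pair_sigma_finite T "lborel :: complex measure" ..
  have N0: "N \<ge> 0" using N[of 0] by linarith
  have "(\<integral>t. moll v \<delta> (y t) \<partial>T) = (\<integral>t. (\<integral>w. v w * ker \<delta> (w - y t) \<partial>lborel) \<partial>T)"
  proof (rule Bochner_Integration.integral_cong)
    fix t
    show "moll v \<delta> (y t) = (\<integral>w. v w * ker \<delta> (w - y t) \<partial>lborel)"
      using integral_complex_translate[of "\<lambda>w. v w * ker \<delta> (w - y t)" "y t"]
      by (simp add: moll_def add.commute)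
  qed simp
  also have "\<dots> = (\<integral>w. (\<integral>t. v w * ker \<delta> (w - y t) \<partial>T) \<partial>lborel)"
  proof (rule P.Fubini_integral[symmetric])
    show "integrable (T \<Otimes>\<^sub>M lborel) (\<lambda>(t, w). v w * ker \<delta> (w - y t))"
    proof (rule integrable_pair_compact_support[OF fin, where B="N * 8" and \<rho>="\<rho> + 2 * \<delta>"])
      show "\<bar>case (t, w) of (t, w) \<Rightarrow> v w * ker \<delta> (w - y t)\<bar> \<le> N * 8" for t w
        using N N0 ker_bound[OF \<delta>] by (auto simp: abs_mult intro!: mult_mono)
    qed (auto simp: ker_diff_eq_0)
  qed
  also have "\<dots> = (\<integral>w. v w * kerpot T y \<delta> w \<partial>lborel)"
    by (simp add: kerpot_def)
  finally show ?thesis by simp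
qed

end

lemma cavg_mono:
  assumes [measurable]: "f \<in> borel_measurable borel" "g \<in> borel_measurable borel"
    and "\<And>z. norm z \<le> norm w + \<bar>h\<bar> \<Longrightarrow> \<bar>f z\<bar> \<le> B" "\<And>z. norm z \<le> norm w + \<bar>h\<bar> \<Longrightarrow> \<bar>g z\<bar> \<le> B" "\<And>z. f z \<le> g z"
  shows "cavg f w h \<le> cavg g w h"
proof -
  have n: "norm (w + of_real h * cis s) \<le> norm w + \<bar>h\<bar>" for s
    using norm_triangle_ineq[of w "of_real h * cis s"] by (simp add: norm_mult)
  show ?thesis
    unfolding cavg_def
    by (intro integral_mono circ_integrable[where B=B]) (use assms n in auto)
qed

lemma cavg_bound:
  assumes [measurable]: "f \<in> borel_measurable borel" and B: "\<And>z. \<bar>f z\<bar> \<le> B"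
  shows "\<bar>cavg f w h\<bar> \<le> B"
proof -
  have "\<bar>cavg f w h\<bar> \<le> (\<integral>s. \<bar>f (w + of_real h * cis s)\<bar> \<partial>circ)"
    unfolding cavg_def by (rule integral_abs_bound)
  also have "\<dots> \<le> B"
    by (intro circ.integral_le_const) (auto intro!: circ_integrable[where B=B] simp: B)
  finally show ?thesis .
qed

text \<open>Averaging over circles is a self-adjoint operation, by translation invariance of Lebesgue measure.\<close>
lemma integral_cavg_adjoint:
  assumes [measurable]: "f \<in> borel_measurable borel" "g \<in> borel_measurable borel"
    and A: "\<And>z. \<bar>f z\<bar> \<le> A" and B: "\<And>z. \<bar>g z\<bar> \<le> B" and 0: "\<And>z. norm z > \<rho> \<Longrightarrow> f z = 0"
  shows "(\<integral>w. f w * cavg g w h \<partial>lborel) = (\<integral>w. cavg f w (- h) * g w \<partial>lborel)"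
proof -
  interpret P: pair_sigma_finite circ "lborel :: complex measure" ..
  have AB: "A \<ge> 0" "B \<ge> 0" using A[of 0] B[of 0] by linarith+
  have "(\<integral>w. f w * cavg g w h \<partial>lborel) = (\<integral>w. (\<integral>s. f w * g (w + of_real h * cis s) \<partial>circ) \<partial>lborel)"
    by (simp add: cavg_def)
  also have "\<dots> = (\<integral>s. (\<integral>w. f w * g (w + of_real h * cis s) \<partial>lborel) \<partial>circ)"
  proof (rule P.Fubini_integral)
    show "integrable (circ \<Otimes>\<^sub>M lborel) (\<lambda>(s, w). f w * g (w + of_real h * cis s))"
    proof (rule integrable_pair_compact_support[where B="A*B" and \<rho>=\<rho>])
      show "\<bar>case (s, w) of (s, w) \<Rightarrow> f w * g (w + of_real h * cis s)\<bar> \<le> A * B" for s w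
        using A B AB by (auto simp: abs_mult intro!: mult_mono)
    qed (auto simp: 0 circ.finite_measure_axioms)
  qed
  also have "\<dots> = (\<integral>s. (\<integral>w. f (w + of_real (-h) * cis s) * g w \<partial>lborel) \<partial>circ)"
  proof (rule Bochner_Integration.integral_cong)
    fix s
    show "(\<integral>w. f w * g (w + of_real h * cis s) \<partial>lborel) = (\<integral>w. f (w + of_real (-h) * cis s) * g w \<partial>lborel)"
      using integral_complex_translate[of "\<lambda>w. f (w + of_real (-h) * cis s) * g w" "of_real h * cis s"] by simp
  qed simp
  also have "\<dots> = (\<integral>w. (\<integral>s. f (w + of_real (-h) * cis s) * g w \<partial>circ) \<partial>lborel)"
  proof (rule P.Fubini_integral[symmetric])
    show "integrable (circ \<Otimes>\<^sub>M lborel) (\<lambda>(s, w). f (w + of_real (-h) * cis s) * g w)"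
    proof (rule integrable_pair_compact_support[where B="A*B" and \<rho>="\<rho> + \<bar>h\<bar>"])
      show "\<bar>case (s, w) of (s, w) \<Rightarrow> f (w + of_real (-h) * cis s) * g w\<bar> \<le> A * B" for s w
        using A B AB by (auto simp: abs_mult intro!: mult_mono)
      show "(case (s, w) of (s, w) \<Rightarrow> f (w + of_real (-h) * cis s) * g w) = 0" if "norm w > \<rho> + \<bar>h\<bar>" for s w
        using 0[of "w + of_real (-h) * cis s"] that norm_diff_ineq[of w "of_real (-h) * cis s"]
        by (simp add: norm_mult)
    qed (auto simp: circ.finite_measure_axioms)
  qed
  also have "\<dots> = (\<integral>w. cavg f w (- h) * g w \<partial>lborel)"
    by (simp add: cavg_def)
  finally show ?thesis .
qed

text \<open>The domination principle at a fixed scale \<open>\<delta>\<close>: the positive part \<open>\<phi>\<close> of the difference \<open>\<Phi>\<close> of the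
  potentials is tested against the superharmonicity of \<open>v\<close>.\<close>
lemma mollified_domination:
  fixes T1 :: "'a measure" and T2 :: "'b measure"
  assumes 1: "finite_measure T1" "y1 \<in> borel_measurable T1" "\<And>t. t \<in> space T1 \<Longrightarrow> norm (y1 t) \<le> \<rho>"
    and 2: "finite_measure T2" "y2 \<in> borel_measurable T2" "\<And>t. t \<in> space T2 \<Longrightarrow> norm (y2 t) \<le> \<rho>"
    and \<delta>: "\<delta> > 0" and K: "K \<ge> 0"
    and v [measurable]: "v \<in> borel_measurable borel" and v0: "\<And>z. 0 \<le> v z" and vN: "\<And>z. v z \<le> N"
    and sm: "\<And>w. norm w \<le> \<rho>' \<Longrightarrow> cavg v w \<delta> \<le> v w"
    and pos: "\<And>w. norm w < \<rho> + 2 * \<delta> \<Longrightarrow> K * logpot T2 y2 \<delta> w \<le> logpot T1 y1 \<delta> w + c"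
    and neg: "\<And>w. norm w > \<rho>' \<Longrightarrow> logpot T1 y1 \<delta> w + c \<le> K * logpot T2 y2 \<delta> w"
  shows "(\<integral>t. moll v \<delta> (y1 t) \<partial>T1) \<le> K * (\<integral>t. moll v \<delta> (y2 t) \<partial>T2)"
proof -
  note m [measurable] = measurable_logpot[OF 1 \<delta>] measurable_logpot[OF 2 \<delta>]
    measurable_kerpot[OF 1 \<delta>] measurable_kerpot[OF 2 \<delta>]
  have vN': "\<bar>v z\<bar> \<le> N" for z using v0[of z] vN[of z] by simp
  have N0: "N \<ge> 0" using vN'[of 0] by linarith
  define \<Phi> where "\<Phi> w = logpot T1 y1 \<delta> w - K * logpot T2 y2 \<delta> w + c" for w
  define \<phi> where "\<phi> w = max 0 (\<Phi> w)" for w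
  have m\<Phi> [measurable]: "\<Phi> \<in> borel_measurable borel" unfolding \<Phi>_def[abs_def] by measurable
  have m\<phi> [measurable]: "\<phi> \<in> borel_measurable borel" unfolding \<phi>_def[abs_def] by measurable
  define C where "C B = (\<bar>ln \<delta>\<bar> + \<bar>ln (max (B + \<rho>) \<delta>)\<bar>) * measure T1 (space T1)
    + K * ((\<bar>ln \<delta>\<bar> + \<bar>ln (max (B + \<rho>) \<delta>)\<bar>) * measure T2 (space T2)) + \<bar>c\<bar>" for B
  have \<Phi>C: "\<bar>\<Phi> w\<bar> \<le> C B" if "norm w \<le> B" for w B
  proof -
    have "\<bar>K * logpot T2 y2 \<delta> w\<bar> \<le> K * ((\<bar>ln \<delta>\<bar> + \<bar>ln (max (B + \<rho>) \<delta>)\<bar>) * measure T2 (space T2))"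
      unfolding abs_mult using logpot_bound[OF 2 \<delta> that] K by (auto intro: mult_left_mono)
    then show ?thesis
      unfolding \<Phi>_def C_def using logpot_bound[OF 1 \<delta> that] by linarith
  qed
  have \<phi>0: "\<phi> w = 0" if "norm w > \<rho>'" for w using neg[OF that] by (simp add: \<phi>_def \<Phi>_def)
  have \<phi>_nn: "\<phi> w \<ge> 0" for w by (simp add: \<phi>_def)
  have \<phi>C: "\<bar>\<phi> w\<bar> \<le> \<bar>C \<rho>'\<bar>" for w
    using \<Phi>C[of w \<rho>'] \<phi>0[of w] by (cases "norm w \<le> \<rho>'") (auto simp: \<phi>_def)
  have cav: "cavg \<phi> w (- \<delta>) * v w - \<phi> w * v w \<ge> v w * kerpot T1 y1 \<delta> w - K * (v w * kerpot T2 y2 \<delta> w)" for w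
  proof -
    \<comment> \<open>Where \<open>\<Phi>\<close> is negative, \<open>w\<close> is out of reach of the mollified first measure, and the left-hand side is at most \<open>0\<close>.\<close>
    have "kerpot T1 y1 \<delta> w - K * kerpot T2 y2 \<delta> w \<le> cavg \<phi> w (- \<delta>) - \<phi> w"
    proof (cases "\<Phi> w \<ge> 0")
      case True
      have "cavg \<Phi> w (- \<delta>) \<le> cavg \<phi> w (- \<delta>)"
        by (rule cavg_mono[where B="C (norm w + \<bar>-\<delta>\<bar>) + \<bar>C \<rho>'\<bar>"])
           (use \<Phi>C \<phi>C in \<open>force simp: \<phi>_def\<close>)+
      moreover have "cavg \<Phi> w (- \<delta>) = cavg (logpot T1 y1 \<delta>) w (- \<delta>) - K * cavg (logpot T2 y2 \<delta>) w (- \<delta>) + c"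
      proof -
        have "integrable circ (\<lambda>s. logpot T1 y1 \<delta> (w + of_real (-\<delta>) * cis s))"
          "integrable circ (\<lambda>s. logpot T2 y2 \<delta> (w + of_real (-\<delta>) * cis s))"
          using norm_triangle_ineq[of w "of_real (-\<delta>) * cis _"]
          by (auto intro!: circ_integrable logpot_bound[OF 1 \<delta>, of _ "norm w + \<bar>\<delta>\<bar>"]
               logpot_bound[OF 2 \<delta>, of _ "norm w + \<bar>\<delta>\<bar>"] simp: norm_mult simp del: of_real_minus)
        then show ?thesis
          using circ.prob_space by (simp add: cavg_def \<Phi>_def del: of_real_minus)
      qed
      ultimately show ?thesis
        using True cavg_logpot[OF 1 \<delta>, of w] cavg_logpot[OF 2 \<delta>, of w]
        by (simp add: \<phi>_def \<Phi>_def algebra_simps)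
    next
      case False
      then have "norm w \<ge> \<rho> + 2 * \<delta>" using pos[of w] by (force simp: \<Phi>_def)
      then have "kerpot T1 y1 \<delta> w = 0" by (intro kerpot_eq_0[OF 1 \<delta>])
      moreover have "K * kerpot T2 y2 \<delta> w \<ge> 0" using K kerpot_nonneg[OF 2 \<delta>] by simp
      moreover have "cavg \<phi> w (- \<delta>) \<ge> 0" unfolding cavg_def by (intro Bochner_Integration.integral_nonneg \<phi>_nn)
      ultimately show ?thesis using False by (simp add: \<phi>_def)
    qed
    from mult_left_mono[OF this v0[of w]] show ?thesis by (simp add: algebra_simps)
  qed
  have int1: "integrable lborel (\<lambda>w. v w * kerpot T1 y1 \<delta> w)"
    by (rule integrable_compact_support[where B="N * (8 * measure T1 (space T1))" and \<rho>="\<rho> + 2 * \<delta>"])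
       (use kerpot_eq_0[OF 1 \<delta>] vN' kerpot_bound[OF 1 \<delta>] N0 in \<open>auto simp: abs_mult intro!: mult_mono\<close>)
  have int2: "integrable lborel (\<lambda>w. v w * kerpot T2 y2 \<delta> w)"
    by (rule integrable_compact_support[where B="N * (8 * measure T2 (space T2))" and \<rho>="\<rho> + 2 * \<delta>"])
       (use kerpot_eq_0[OF 2 \<delta>] vN' kerpot_bound[OF 2 \<delta>] N0 in \<open>auto simp: abs_mult intro!: mult_mono\<close>)
  have int3: "integrable lborel (\<lambda>w. \<phi> w * v w)"
    by (rule integrable_compact_support[where B="\<bar>C \<rho>'\<bar> * N" and \<rho>=\<rho>'])
       (use \<phi>0 vN' \<phi>C N0 in \<open>auto simp: abs_mult intro!: mult_mono\<close>)
  have int4: "integrable lborel (\<lambda>w. \<phi> w * cavg v w \<delta>)"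
    by (rule integrable_compact_support[where B="\<bar>C \<rho>'\<bar> * N" and \<rho>=\<rho>'])
       (use \<phi>0 cavg_bound[OF v vN'] \<phi>C N0 in \<open>auto simp: abs_mult intro!: mult_mono\<close>)
  have int5: "integrable lborel (\<lambda>w. cavg \<phi> w (- \<delta>) * v w)"
  proof (rule integrable_compact_support[where B="\<bar>C \<rho>'\<bar> * N" and \<rho>="\<rho>' + \<delta>"])
    show "cavg \<phi> w (- \<delta>) * v w = 0" if "norm w > \<rho>' + \<delta>" for w
    proof -
      have "\<phi> (w + of_real (-\<delta>) * cis s) = 0" for s
        using that \<delta> norm_diff_ineq[of w "of_real (-\<delta>) * cis s"] by (intro \<phi>0) (simp add: norm_mult)
      then show ?thesis by (simp add: cavg_def)
    qed
    show "\<bar>cavg \<phi> w (- \<delta>) * v w\<bar> \<le> \<bar>C \<rho>'\<bar> * N" for w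
      using cavg_bound[OF m\<phi> \<phi>C] vN' by (auto simp: abs_mult intro!: mult_mono)
  qed measurable
  have "(\<integral>w. v w * kerpot T1 y1 \<delta> w - K * (v w * kerpot T2 y2 \<delta> w) \<partial>lborel)
      \<le> (\<integral>w. cavg \<phi> w (- \<delta>) * v w - \<phi> w * v w \<partial>lborel)"
    by (intro integral_mono Bochner_Integration.integrable_diff integrable_mult_right int1 int2 int3 int5 cav)
  also have "\<dots> = (\<integral>w. \<phi> w * cavg v w \<delta> \<partial>lborel) - (\<integral>w. \<phi> w * v w \<partial>lborel)"
    by (subst Bochner_Integration.integral_diff[OF int5 int3], subst integral_cavg_adjoint[OF m\<phi> v \<phi>C vN' \<phi>0]) auto
  also have "\<dots> \<le> 0"
  proof -
    have "\<phi> w * cavg v w \<delta> \<le> \<phi> w * v w" for w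
      using sm[of w] \<phi>_nn[of w] \<phi>0[of w] by (cases "norm w \<le> \<rho>'") (auto intro: mult_left_mono)
    then have "(\<integral>w. \<phi> w * cavg v w \<delta> \<partial>lborel) \<le> (\<integral>w. \<phi> w * v w \<partial>lborel)"
      by (intro integral_mono int3 int4)
    then show ?thesis by simp
  qed
  finally show ?thesis
    using int1 int2 integral_kerpot[OF 1 \<delta> v vN'] integral_kerpot[OF 2 \<delta> v vN'] by simp
qed


lemma measurable_moll [measurable]:
  assumes [measurable]: "v \<in> borel_measurable borel"
  shows "moll v \<delta> \<in> borel_measurable borel"
  unfolding moll_def[abs_def] by measurable

text \<open>For lower semicontinuous \<open>v\<close> the mollifications cannot stay below \<open>v y\<close> in the limit; together with the
  upper bound for superharmonic functions this is convergence.\<close>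
lemma moll_tendsto:
  assumes v: "v \<in> borel_measurable borel" "\<And>z. \<bar>v z\<bar> \<le> N"
    and lsc: "\<And>c. open {z. c < v z}"
    and d: "\<And>n. d n > 0" "d \<longlonglongrightarrow> 0"
    and up: "\<And>n. moll v (d n) y \<le> v y * kmass (d n)"
  shows "(\<lambda>n. moll v (d n) y / kmass (d n)) \<longlonglongrightarrow> v y"
proof (rule LIMSEQ_I)
  fix e :: real assume e: "e > 0"
  have "y \<in> {z. v y - e / 2 < v z}" using e by simp
  then obtain \<eta> where \<eta>: "\<eta> > 0" "ball y \<eta> \<subseteq> {z. v y - e / 2 < v z}"
    using lsc open_contains_ball by blast
  obtain n0 where n0: "\<And>n. n \<ge> n0 \<Longrightarrow> norm (d n) < \<eta> / 2"
    using LIMSEQ_D[OF d(2), of "\<eta> / 2"] \<eta> by auto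
  show "\<exists>no. \<forall>n\<ge>no. norm (moll v (d n) y / kmass (d n) - v y) < e"
  proof (intro exI allI impI)
    fix n assume "n \<ge> n0"
    have "(v y - e / 2) * kmass (d n) \<le> moll v (d n) y"
      using n0[OF \<open>n \<ge> n0\<close>] \<eta>(2) d(1)[of n]
      by (intro moll_lower[OF d(1) v]) (auto simp: subset_iff less_imp_le)
    then have "v y - e / 2 \<le> moll v (d n) y / kmass (d n)" "moll v (d n) y / kmass (d n) \<le> v y"
      using kmass_pos[OF d(1), of n] up[of n] by (simp_all add: pos_le_divide_eq pos_divide_le_eq)
    then show "norm (moll v (d n) y / kmass (d n) - v y) < e" using e by simp
  qed
qed

text \<open>The domination principle proper, in the limit \<open>\<delta> \<longlongrightarrow> 0\<close>.  The additive constant \<open>c \<delta>\<close> in the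
  comparison of the potentials may depend on the scale.\<close>
lemma superharmonic_domination:
  fixes T1 :: "'a measure" and T2 :: "'b measure"
  assumes 1: "finite_measure T1" "y1 \<in> borel_measurable T1" "\<And>t. t \<in> space T1 \<Longrightarrow> norm (y1 t) \<le> \<rho>"
    and 2: "finite_measure T2" "y2 \<in> borel_measurable T2" "\<And>t. t \<in> space T2 \<Longrightarrow> norm (y2 t) \<le> \<rho>"
    and \<rho>: "\<rho> \<le> \<rho>'" "\<rho>' < R'" and K: "K \<ge> 0"
    and v [measurable]: "v \<in> borel_measurable borel" and v0: "\<And>z. 0 \<le> v z" and vN: "\<And>z. v z \<le> N"
    and lsc: "\<And>c. open {z. c < v z}"
    and sm: "\<And>w h. 0 < h \<Longrightarrow> norm w + h < R' \<Longrightarrow> cavg v w h \<le> v w"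
    and \<epsilon>: "\<epsilon> > 0"
    and pos: "\<And>w \<delta>. 0 < \<delta> \<Longrightarrow> \<delta> \<le> \<epsilon> \<Longrightarrow> norm w < \<rho> + 2 * \<delta> \<Longrightarrow>
      K * logpot T2 y2 \<delta> w \<le> logpot T1 y1 \<delta> w + c \<delta>"
    and neg: "\<And>w \<delta>. 0 < \<delta> \<Longrightarrow> \<delta> \<le> \<epsilon> \<Longrightarrow> norm w > \<rho>' \<Longrightarrow>
      logpot T1 y1 \<delta> w + c \<delta> \<le> K * logpot T2 y2 \<delta> w"
  shows "(\<integral>t. v (y1 t) \<partial>T1) \<le> K * (\<integral>t. v (y2 t) \<partial>T2)"
proof -
  interpret T1: finite_measure T1 by fact
  interpret T2: finite_measure T2 by fact
  have [measurable]: "y1 \<in> borel_measurable T1" "y2 \<in> borel_measurable T2" by fact+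
  have vN': "\<bar>v z\<bar> \<le> N" for z using v0[of z] vN[of z] by simp
  define \<delta>1 where "\<delta>1 = min \<epsilon> ((R' - \<rho>') / 2)"
  define d where "d n = \<delta>1 * inverse (real (Suc n))" for n
  have \<delta>1: "\<delta>1 > 0" using \<epsilon> \<rho> by (simp add: \<delta>1_def)
  have d0: "d n > 0" for n using \<delta>1 by (simp add: d_def)
  have d1: "d n \<le> \<delta>1" for n using \<delta>1 by (simp add: d_def field_simps)
  have dlim: "d \<longlonglongrightarrow> 0"
    using tendsto_mult_right[OF LIMSEQ_inverse_real_of_nat, of \<delta>1] by (simp add: d_def[abs_def] mult.commute)
  have d2: "2 * d n \<le> R' - \<rho>'" "d n \<le> \<epsilon>" for n using d1[of n] by (auto simp: \<delta>1_def)
  have up: "moll v (d n) y \<le> v y * kmass (d n)" if "norm y \<le> \<rho>" for n y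
  proof (rule moll_upper[OF d0 v vN'])
    show "cavg v y h \<le> v y" if "0 < h" "h < 2 * d n" for h
      using that \<open>norm y \<le> \<rho>\<close> d2[of n] \<rho> by (intro sm) auto
  qed
  have lo: "0 \<le> moll v (d n) y" for n y
    using moll_lower[OF d0 v vN', of y n 0] v0 by simp
  have quo: "0 \<le> moll v (d n) y / kmass (d n)" "moll v (d n) y / kmass (d n) \<le> v y" if "norm y \<le> \<rho>" for n y
    using up[OF that, of n] lo[of n y] kmass_pos[OF d0, of n] by (auto simp: field_simps)
  have step: "(\<integral>t. moll v (d n) (y1 t) / kmass (d n) \<partial>T1) \<le> K * (\<integral>t. v (y2 t) \<partial>T2)" for n
  proof -
    have "(\<integral>t. moll v (d n) (y1 t) \<partial>T1) \<le> K * (\<integral>t. moll v (d n) (y2 t) \<partial>T2)"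
    proof (rule mollified_domination[OF 1 2 d0 K v v0 vN, where c="c (d n)"])
      show "cavg v w (d n) \<le> v w" if "norm w \<le> \<rho>'" for w
        using that d0[of n] d2[of n] by (intro sm) auto
    qed (use pos neg d0 d2 in auto)
    also have "\<dots> \<le> K * (\<integral>t. v (y2 t) * kmass (d n) \<partial>T2)"
    proof (intro mult_left_mono K integral_mono)
      show "integrable T2 (\<lambda>t. moll v (d n) (y2 t))"
      proof (rule T2.integrable_const_bound[where B="N * kmass (d n)"])
        show "AE t in T2. norm (moll v (d n) (y2 t)) \<le> N * kmass (d n)"
        proof (rule AE_I2)
          fix t assume "t \<in> space T2"
          then have "moll v (d n) (y2 t) \<le> v (y2 t) * kmass (d n)" by (intro up 2)
          also have "\<dots> \<le> N * kmass (d n)" using vN kmass_pos[OF d0, of n] by (intro mult_right_mono) auto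
          finally show "norm (moll v (d n) (y2 t)) \<le> N * kmass (d n)" using lo by simp
        qed
      qed measurable
      show "integrable T2 (\<lambda>t. v (y2 t) * kmass (d n))"
        using vN' by (intro integrable_mult_left T2.integrable_const_bound[where B=N]) auto
      show "moll v (d n) (y2 t) \<le> v (y2 t) * kmass (d n)" if "t \<in> space T2" for t
        using that by (intro up 2)
    qed
    finally show ?thesis using kmass_pos[OF d0, of n] by (simp add: field_simps)
  qed
  have "(\<lambda>n. \<integral>t. moll v (d n) (y1 t) / kmass (d n) \<partial>T1) \<longlonglongrightarrow> (\<integral>t. v (y1 t) \<partial>T1)"
  proof (rule integral_dominated_convergence[where w="\<lambda>_. N"])
    show "AE t in T1. (\<lambda>n. moll v (d n) (y1 t) / kmass (d n)) \<longlonglongrightarrow> v (y1 t)"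
      by (intro AE_I2 moll_tendsto[OF v vN' lsc d0 dlim] up 1)
    show "AE t in T1. norm (moll v (d n) (y1 t) / kmass (d n)) \<le> N" for n
    proof (rule AE_I2)
      fix t assume "t \<in> space T1"
      then have "norm (y1 t) \<le> \<rho>" by (rule 1)
      from quo[OF this, of n] vN[of "y1 t"] show "norm (moll v (d n) (y1 t) / kmass (d n)) \<le> N" by simp
    qed
  qed auto
  then show ?thesis by (rule LIMSEQ_le_const2) (use step in auto)
qed

section \<open>Estimates of the two potentials\<close>
lemma logpot_circle:
  "logpot circ (\<lambda>s. of_real r0 * cis s) \<delta> w = cavg (lnt \<delta>) w (- r0)"
  by (simp add: logpot_def cavg_def)

text \<open>The truncation at \<open>\<delta>\<close> is majorised by replacing \<open>\<bar>\<zeta>\<bar>\<close> with \<open>sqrt (\<bar>\<zeta>\<bar>\<^sup>2 + \<delta>\<^sup>2)\<close>, whose logarithm has an explicit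
  mean: on the circle it equals the distance of \<open>\<alpha> u + \<beta> e\<^sup>i\<^sup>s\<close> from the origin for suitable \<open>\<alpha> > \<bar>\<beta>\<bar>\<close>, so
  that the mean value property gives \<open>ln \<alpha>\<close>.\<close>
lemma cavg_lnt_le:
  assumes \<delta>: "\<delta> > 0"
  shows "cavg (lnt \<delta>) w h \<le> ln (max (norm w) \<bar>h\<bar> + \<delta>)"
proof -
  define p q where "p = sqrt ((norm w + h)\<^sup>2 + \<delta>\<^sup>2)" and "q = sqrt ((norm w - h)\<^sup>2 + \<delta>\<^sup>2)"
  define \<alpha> \<beta> where "\<alpha> = (p + q) / 2" and "\<beta> = (p - q) / 2"
  have pq: "p > 0" "q > 0" using \<delta> by (auto simp: p_def q_def intro!: add_nonneg_pos)
  have p2: "p\<^sup>2 = (norm w + h)\<^sup>2 + \<delta>\<^sup>2" "q\<^sup>2 = (norm w - h)\<^sup>2 + \<delta>\<^sup>2" by (auto simp: p_def q_def)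
  have "\<alpha>\<^sup>2 + \<beta>\<^sup>2 = (p\<^sup>2 + q\<^sup>2) / 2" by (simp add: \<alpha>_def \<beta>_def power2_eq_square field_simps)
  then have sq: "\<alpha>\<^sup>2 + \<beta>\<^sup>2 = (norm w)\<^sup>2 + h\<^sup>2 + \<delta>\<^sup>2" unfolding p2 by (simp add: power2_eq_square field_simps)
  have "\<alpha> * \<beta> = (p\<^sup>2 - q\<^sup>2) / 4" by (simp add: \<alpha>_def \<beta>_def power2_eq_square field_simps)
  then have pr: "\<alpha> * \<beta> = norm w * h" unfolding p2 by (simp add: power2_eq_square field_simps)
  have ab: "\<bar>\<beta>\<bar> < \<alpha>" using pq by (auto simp: \<alpha>_def \<beta>_def)
  obtain u where u: "norm u = 1" "w = of_real (norm w) * u"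
  proof (cases "w = 0")
    case False
    then show ?thesis by (intro that[of "w / of_real (norm w)"]) (auto simp: norm_divide)
  qed (use that[of 1] in auto)
  have nu: "norm (of_real \<alpha> * u) = \<alpha>" using ab u by (simp add: norm_mult)
  have le: "lnt \<delta> (w + of_real h * cis s) \<le> ln (norm (of_real \<alpha> * u + of_real \<beta> * cis s))" for s
  proof -
    have e: "(norm (of_real a * u + of_real c * cis s))\<^sup>2 = a\<^sup>2 + c\<^sup>2 + 2 * (a * c) * (u \<bullet> cis s)" for a c
    proof -
      have "(norm (of_real a * u + of_real c * cis s))\<^sup>2 = (norm (a *\<^sub>R u + c *\<^sub>R cis s))\<^sup>2"
        by (simp add: scaleR_conv_of_real)
      also have "\<dots> = a\<^sup>2 * (u \<bullet> u) + c\<^sup>2 * (cis s \<bullet> cis s) + 2 * (a * c) * (u \<bullet> cis s)"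
        unfolding power2_norm_eq_inner
        by (simp add: inner_add_left inner_add_right inner_commute power2_eq_square algebra_simps)
      finally show ?thesis using u by (simp add: dot_square_norm)
    qed
    have "(norm (w + of_real h * cis s))\<^sup>2 + \<delta>\<^sup>2 = (norm (of_real \<alpha> * u + of_real \<beta> * cis s))\<^sup>2"
    proof -
      have "(norm (w + of_real h * cis s))\<^sup>2 + \<delta>\<^sup>2 = (norm w)\<^sup>2 + h\<^sup>2 + 2 * (norm w * h) * (u \<bullet> cis s) + \<delta>\<^sup>2"
        by (subst u(2), subst e) simp
      also have "\<dots> = \<alpha>\<^sup>2 + \<beta>\<^sup>2 + 2 * (\<alpha> * \<beta>) * (u \<bullet> cis s)" using sq pr by simp
      finally show ?thesis by (simp add: e)
    qed
    moreover have "(max (norm (w + of_real h * cis s)) \<delta>)\<^sup>2 \<le> (norm (w + of_real h * cis s))\<^sup>2 + \<delta>\<^sup>2"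
      by (simp add: max_def)
    ultimately have "(max (norm (w + of_real h * cis s)) \<delta>)\<^sup>2 \<le> (norm (of_real \<alpha> * u + of_real \<beta> * cis s))\<^sup>2"
      by simp
    then have "max (norm (w + of_real h * cis s)) \<delta> \<le> norm (of_real \<alpha> * u + of_real \<beta> * cis s)"
      by (rule power2_le_imp_le) simp
    then show ?thesis unfolding lnt_def using \<delta> by (intro ln_mono) auto
  qed
  have i: "integrable circ (\<lambda>s. ln (norm (of_real \<alpha> * u + of_real \<beta> * cis s)))"
  proof (rule circ_integrable)
    fix s
    have "\<alpha> - \<bar>\<beta>\<bar> \<le> norm (of_real \<alpha> * u + of_real \<beta> * cis s)" "norm (of_real \<alpha> * u + of_real \<beta> * cis s) \<le> \<alpha> + \<bar>\<beta>\<bar>"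
      using norm_diff_ineq[of "of_real \<alpha> * u" "of_real \<beta> * cis s"]
        norm_triangle_ineq[of "of_real \<alpha> * u" "of_real \<beta> * cis s"] nu by (simp_all add: norm_mult)
    then have "ln (\<alpha> - \<bar>\<beta>\<bar>) \<le> ln (norm (of_real \<alpha> * u + of_real \<beta> * cis s))"
      "ln (norm (of_real \<alpha> * u + of_real \<beta> * cis s)) \<le> ln (\<alpha> + \<bar>\<beta>\<bar>)"
      using ab by (auto intro!: ln_mono)
    then show "\<bar>ln (norm (of_real \<alpha> * u + of_real \<beta> * cis s))\<bar> \<le> \<bar>ln (\<alpha> - \<bar>\<beta>\<bar>)\<bar> + \<bar>ln (\<alpha> + \<bar>\<beta>\<bar>)\<bar>" by linarith
  qed measurable
  have "cavg (lnt \<delta>) w h \<le> cavg (\<lambda>\<zeta>. ln (norm \<zeta>)) (of_real \<alpha> * u) \<beta>"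
    unfolding cavg_def by (intro integral_mono circ_integrable_lnt \<delta> i le)
  also have "\<dots> = ln \<alpha>" using cavg_ln_norm[of \<beta> "of_real \<alpha> * u"] ab nu by simp
  also have "\<dots> \<le> ln (max (norm w) \<bar>h\<bar> + \<delta>)"
  proof (rule ln_mono)
    have "p \<le> \<bar>norm w + h\<bar> + \<delta>" "q \<le> \<bar>norm w - h\<bar> + \<delta>"
      using sqrt_add_le_add_sqrt[of "(norm w + h)\<^sup>2" "\<delta>\<^sup>2"] sqrt_add_le_add_sqrt[of "(norm w - h)\<^sup>2" "\<delta>\<^sup>2"] \<delta>
      by (auto simp: p_def q_def)
    moreover have "\<bar>norm w + h\<bar> + \<bar>norm w - h\<bar> = 2 * max (norm w) \<bar>h\<bar>"
      using norm_ge_zero[of w] by linarith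
    ultimately show "\<alpha> \<le> max (norm w) \<bar>h\<bar> + \<delta>" unfolding \<alpha>_def by simp
  qed (use ab in auto)
  finally show ?thesis .
qed


lemma nn_integral_inverse_sqrt:
  assumes m: "m > 0"
  shows "(\<integral>\<^sup>+t. ennreal (indicator {x - m..x + m} t * \<bar>x - t\<bar> powr (- 1 / 2)) \<partial>lborel) = ennreal (4 * sqrt m)"
proof -
  define f :: "real \<Rightarrow> real" where "f = (\<lambda>s. \<bar>s\<bar> powr (- 1 / 2))"
  have [measurable]: "f \<in> borel_measurable borel" unfolding f_def by measurable
  have "((\<lambda>s. s powr (- 1 / 2)) has_integral (m powr (- 1 / 2 + 1) / (- 1 / 2 + 1))) {0..m}"
    using m by (intro has_integral_powr_from_0) auto
  then have "((\<lambda>s. s powr (- 1 / 2)) has_integral (2 * sqrt m)) {0..m}"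
    using m by (simp add: powr_half_sqrt mult.commute)
  then have p: "(f has_integral (2 * sqrt m)) {0..m}"
    by (rule has_integral_eq[rotated]) (auto simp: f_def)
  then have "((\<lambda>s. f (- s)) has_integral (2 * sqrt m)) {- m..- 0}"
    using has_integral_reflect_real[where f=f and a=0 and b=m] by simp
  then have "(f has_integral (2 * sqrt m)) {- m..0}" by (simp add: f_def)
  then have "(f has_integral (2 * sqrt m + 2 * sqrt m)) {- m..m}"
    using p m by (intro has_integral_combine[where c=0]) auto
  then have "((\<lambda>s. if s \<in> {- m..m} then f s else 0) has_integral (4 * sqrt m)) UNIV"
    by (subst has_integral_restrict_UNIV) simp
  then have "((\<lambda>s. indicator {- m..m} s * f s) has_integral (4 * sqrt m)) UNIV"
    by (rule has_integral_eq[rotated]) (auto simp: indicator_def)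
  then have "(\<integral>\<^sup>+s. ennreal (indicator {- m..m} s * f s) \<partial>lborel) = ennreal (4 * sqrt m)"
    by (intro nn_integral_has_integral_lborel) (auto simp: f_def)
  also have "(\<integral>\<^sup>+s. ennreal (indicator {- m..m} s * f s) \<partial>lborel)
      = (\<integral>\<^sup>+t. ennreal (indicator {- m..m} (- x + 1 * t) * f (- x + 1 * t)) \<partial>lborel)"
    using nn_integral_real_affine[of "\<lambda>s. ennreal (indicator {- m..m} s * f s)" 1 "-x"] by simp
  also have "(\<lambda>t. ennreal (indicator {- m..m} (- x + 1 * t) * f (- x + 1 * t)))
      = (\<lambda>t. ennreal (indicator {x - m..x + m} t * \<bar>x - t\<bar> powr (- 1 / 2)))"
    by (auto simp: fun_eq_iff f_def indicator_def abs_minus_commute)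
  finally show ?thesis .
qed

lemma ln_le_two_sqrt:
  fixes y :: real
  assumes "y > 0"
  shows "ln y \<le> 2 * sqrt y"
proof -
  have "ln y = 2 * ln (sqrt y)" using assms by (simp add: ln_sqrt)
  also have "\<dots> \<le> 2 * sqrt y" using ln_le_minus_one[of "sqrt y"] assms by simp
  finally show ?thesis .
qed

text \<open>The bound does not depend on the angles of the points \<open>z t\<close>.  It uses \<open>ln (m / s) \<le> 2 sqrt (m / s)\<close> for the
  distance \<open>s = \<bar>\<bar>w\<bar> - t\<bar>\<close> when \<open>s \<le> m\<close>; the integral of the right-hand side over \<open>t\<close> is at most \<open>8 m\<close>.\<close>
lemma logpot_lower:
  fixes E :: "real set"
  assumes E: "E \<in> lmeasurable" and z [measurable]: "z \<in> borel_measurable (lebesgue_on E)"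
    and zn: "\<And>t. t \<in> E \<Longrightarrow> norm (z t) = t" and zb: "\<And>t. t \<in> E \<Longrightarrow> t \<le> R"
    and \<delta>: "\<delta> > 0" and m: "m = measure lebesgue E" "m > 0"
  shows "m * ln m - 8 * m \<le> logpot (lebesgue_on E) z \<delta> w"
proof -
  have fin: "finite_measure (lebesgue_on E)" using E by (rule finite_measure_lebesgue_on)
  interpret finite_measure "lebesgue_on E" by fact
  have sp: "space (lebesgue_on E) = E" by (simp add: space_restrict_space)
  have ms: "measure (lebesgue_on E) E = m" using E m by (simp add: measure_restrict_space fmeasurableD)
  define x where "x = norm w"
  define g where "g t = indicator {x - m..x + m} t * \<bar>x - t\<bar> powr (- 1 / 2)" for t
  have [measurable]: "g \<in> borel_measurable borel" unfolding g_def[abs_def] by measurable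
  have g0: "g t \<ge> 0" for t by (simp add: g_def)
  have ig: "integrable lborel g" "(\<integral>t. g t \<partial>lborel) = 4 * sqrt m"
    using nn_integral_inverse_sqrt[OF m(2), of x] g0 m(2) unfolding g_def[symmetric]
    by (auto intro: integrableI_nn_integral_finite simp: integral_eq_nn_integral)
  then have ig': "integrable lebesgue g" "(\<integral>t. g t \<partial>lebesgue) = 4 * sqrt m"
    by (simp_all add: integrable_completion integral_completion)
  have iE: "integrable (lebesgue_on E) g"
    using integrable_restrict_space[of E lebesgue g] integrable_mult_indicator[OF fmeasurableD[OF E] ig'(1)] E
    by (simp add: fmeasurableD)
  have "(\<integral>t. g t \<partial>lebesgue_on E) = (\<integral>t. indicator E t *\<^sub>R g t \<partial>lebesgue)"
    using E by (subst integral_restrict_space) (auto simp: fmeasurableD)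
  also have "\<dots> \<le> (\<integral>t. g t \<partial>lebesgue)"
    using E ig' g0 by (intro integral_mono integrable_mult_indicator) (auto simp: fmeasurableD indicator_def)
  finally have gE: "(\<integral>t. g t \<partial>lebesgue_on E) \<le> 4 * sqrt m" using ig' by simp
  have "m * ln m - 8 * m \<le> m * ln m - 2 * sqrt m * (\<integral>t. g t \<partial>lebesgue_on E)"
  proof -
    have "2 * sqrt m * (\<integral>t. g t \<partial>lebesgue_on E) \<le> 2 * sqrt m * (4 * sqrt m)"
      using gE m by (intro mult_left_mono) auto
    also have "2 * sqrt m * (4 * sqrt m) = 8 * (sqrt m * sqrt m)" by simp
    also have "\<dots> = 8 * m" using m(2) by simp
    finally show ?thesis by simp
  qed
  also have "\<dots> = (\<integral>t. ln m - 2 * sqrt m * g t \<partial>lebesgue_on E)"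
    using iE ms sp by (simp add: mult.commute)
  also have "\<dots> \<le> logpot (lebesgue_on E) z \<delta> w"
    unfolding logpot_def
  proof (rule integral_mono_AE)
    show "integrable (lebesgue_on E) (\<lambda>t. lnt \<delta> (w - z t))"
      using integrable_lnt_diff[OF fin z _ \<delta>, of R w] zn zb sp by auto
    show "integrable (lebesgue_on E) (\<lambda>t. ln m - 2 * sqrt m * g t)" using iE by auto
    have "AE t in lborel. t \<noteq> x" by (rule AE_lborel_singleton)
    then have "AE t in lebesgue. t \<noteq> x" by (rule AE_completion)
    then have "AE t in lebesgue. t \<in> E \<longrightarrow> t \<noteq> x" by eventually_elim auto
    then have "AE t in lebesgue_on E. t \<in> E \<and> t \<noteq> x"
      using E by (subst AE_restrict_space_iff) (auto simp: fmeasurableD)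
    then show "AE t in lebesgue_on E. ln m - 2 * sqrt m * g t \<le> lnt \<delta> (w - z t)"
    proof eventually_elim
      fix t assume t: "t \<in> E \<and> t \<noteq> x"
      define s where "s = \<bar>x - t\<bar>"
      have s: "s > 0" using t by (simp add: s_def)
      have "s \<le> norm (w - z t)" using norm_triangle_ineq3[of w "z t"] zn t by (simp add: s_def x_def)
      then have l: "ln s \<le> lnt \<delta> (w - z t)" unfolding lnt_def using s by (intro ln_mono) auto
      show "ln m - 2 * sqrt m * g t \<le> lnt \<delta> (w - z t)"
      proof (cases "s \<le> m")
        case True
        have "g t = 1 / sqrt s" using True s by (auto simp: g_def s_def indicator_def powr_minus_divide powr_half_sqrt abs_le_iff)
        then have "2 * sqrt m * g t = 2 * sqrt (m / s)" by (simp add: real_sqrt_divide)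
        moreover have "ln (m / s) \<le> 2 * sqrt (m / s)" using m s by (intro ln_le_two_sqrt) auto
        moreover have "ln (m / s) = ln m - ln s" using m s by (simp add: ln_div)
        ultimately show ?thesis using l by linarith
      next
        case False
        then have "ln m \<le> ln s" using m by simp
        moreover have "2 * sqrt m * g t \<ge> 0" using g0 m by simp
        ultimately show ?thesis using l by linarith
      qed
    qed
  qed
  finally show ?thesis .
qed

text \<open>The room left between the radii \<open>(1 + b / 4) R\<close> and \<open>(1 + 3 b / 4) R\<close>, on a logarithmic scale.\<close>
lemma ln_ratio_lower:
  fixes b x :: real
  assumes b: "0 < b" "b \<le> 1" and x: "x \<ge> 1 + 3 * b / 4"
  shows "2 * b / 7 \<le> ln (x / (1 + b / 4))"
proof -
  define y where "y = x / (1 + b / 4)"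
  have y: "y > 0" using b x by (simp add: y_def)
  have "1 / y = (1 + b / 4) / x" by (simp add: y_def)
  also have "\<dots> \<le> (1 + b / 4) / (1 + 3 * b / 4)" using b x by (intro divide_left_mono) auto
  also have "\<dots> \<le> 1 - 2 * b / 7"
  proof -
    have "(1 - 2 * b / 7) * (1 + 3 * b / 4) = (1 + b / 4) + 3 / 14 * (b * (1 - b))" by (simp add: field_simps)
    moreover have "0 \<le> b * (1 - b)" using b by simp
    ultimately have "1 + b / 4 \<le> (1 - 2 * b / 7) * (1 + 3 * b / 4)" by linarith
    then show ?thesis using b by (subst pos_divide_le_eq) auto
  qed
  finally have "1 / y \<le> 1 - 2 * b / 7" .
  moreover have "ln (1 / y) \<le> 1 / y - 1" using y by (intro ln_le_minus_one) auto
  moreover have "ln (1 / y) = - ln y" using y by (simp add: ln_div)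
  ultimately show ?thesis by (simp add: y_def)
qed

text \<open>The potential of the curve \<open>z\<close> is compared with \<open>K\<close> times that of the circle of radius \<open>r0\<close>.  The choice of
  \<open>c \<delta>\<close> makes the comparison hold near the disc of radius \<open>R\<close>; the size of \<open>K\<close> reverses it outside the disc of
  radius \<open>(1 + 3 b / 4) R\<close>.\<close>
lemma superharmonic_selection_bound:
  fixes E :: "real set"
  assumes E: "E \<in> lmeasurable" "E \<subseteq> {0..R}" and z [measurable]: "z \<in> borel_measurable (lebesgue_on E)"
    and zn: "\<And>t. t \<in> E \<Longrightarrow> norm (z t) = t"
    and m: "m = measure lebesgue E" "m > 0" and r0: "0 \<le> r0" "r0 \<le> R" and R: "R > 0" and b: "0 < b" "b \<le> 1"
    and v [measurable]: "v \<in> borel_measurable borel" and v0: "\<And>z. 0 \<le> v z" and vN: "\<And>z. v z \<le> N"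
    and lsc: "\<And>c. open {z. c < v z}"
    and sm: "\<And>w h. 0 < h \<Longrightarrow> norm w + h < (1 + b) * R \<Longrightarrow> cavg v w h \<le> v w"
  shows "(\<integral>t. v (z t) \<partial>lebesgue_on E) \<le> 7 / (2 * b) * m * (10 + ln (R / m)) * cavg v 0 r0"
proof -
  define K where "K = 7 / (2 * b) * m * (10 + ln (R / m))"
  define c where "c \<delta> = K * ln (R + 3 * \<delta>) + 8 * m - m * ln m" for \<delta>
  have fin: "finite_measure (lebesgue_on E)" using E by (intro finite_measure_lebesgue_on)
  have sp: "space (lebesgue_on E) = E" by (simp add: space_restrict_space)
  have ms: "measure (lebesgue_on E) E = m" using E m by (simp add: measure_restrict_space fmeasurableD)
  have zR: "norm (z t) \<le> R" if "t \<in> E" for t using zn[OF that] that E by auto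
  have "m \<le> measure lebesgue {0..R}" unfolding m(1) using E by (intro measure_mono_fmeasurable) (auto simp: fmeasurableD)
  then have mR: "m \<le> R" using R by simp
  then have L: "ln (R / m) \<ge> 0" using m by simp
  have K0: "K \<ge> 0" unfolding K_def using L m b by simp
  have "(\<integral>t. v (z t) \<partial>lebesgue_on E) \<le> K * (\<integral>s. v (of_real r0 * cis s) \<partial>circ)"
  proof (rule superharmonic_domination[where \<rho>=R and \<rho>'="(1 + 3 * b / 4) * R" and R'="(1 + b) * R"
        and N=N and \<epsilon>="b * R / 12" and c=c])
    show "norm (of_real r0 * cis s) \<le> R" for s using r0 by (simp add: norm_mult)
    show "R \<le> (1 + 3 * b / 4) * R" "(1 + 3 * b / 4) * R < (1 + b) * R" "0 < b * R / 12"
      using R b by (auto simp: field_simps)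
    show "K * logpot circ (\<lambda>s. of_real r0 * cis s) \<delta> w \<le> logpot (lebesgue_on E) z \<delta> w + c \<delta>"
      if "0 < \<delta>" "norm w < R + 2 * \<delta>" for w \<delta>
    proof -
      have "logpot circ (\<lambda>s. of_real r0 * cis s) \<delta> w \<le> ln (max (norm w) \<bar>- r0\<bar> + \<delta>)"
        unfolding logpot_circle using that by (intro cavg_lnt_le)
      also have "\<dots> \<le> ln (R + 3 * \<delta>)" using that r0 by (intro ln_mono) auto
      finally have "K * logpot circ (\<lambda>s. of_real r0 * cis s) \<delta> w \<le> K * ln (R + 3 * \<delta>)"
        using K0 by (rule mult_left_mono)
      moreover have "m * ln m - 8 * m \<le> logpot (lebesgue_on E) z \<delta> w"
        using E zR that(1) m by (intro logpot_lower[where R=R] z zn) auto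
      ultimately show ?thesis unfolding c_def by linarith
    qed
    show "logpot (lebesgue_on E) z \<delta> w + c \<delta> \<le> K * logpot circ (\<lambda>s. of_real r0 * cis s) \<delta> w"
      if \<delta>: "0 < \<delta>" "\<delta> \<le> b * R / 12" and w: "(1 + 3 * b / 4) * R < norm w" for w \<delta>
    proof -
      \<comment> \<open>With \<open>y\<close> the logarithmic distance beyond \<open>(1 + b / 4) R\<close>, it suffices that \<open>m (9 + y + ln (R / m)) \<le> K y\<close>.\<close>
      define x where "x = norm w / R"
      define y where "y = ln (x / (1 + b / 4))"
      have bR: "b * R > 0" using b R by simp
      have wb: "norm w \<ge> R + 3 * (b * R) / 4" using w by (simp add: algebra_simps)
      have x: "x \<ge> 1 + 3 * b / 4" using w R by (simp add: x_def field_simps)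
      have x0: "x > 0" "1 + b / 4 > 0" using x b by auto
      have w0: "norm w > 0" "norm w \<ge> \<bar>-r0\<bar> + \<delta>" using wb \<delta> r0 bR R by auto
      have circ_eq: "logpot circ (\<lambda>s. of_real r0 * cis s) \<delta> w = ln (norm w)"
        unfolding logpot_circle using \<delta> w0 by (intro cavg_lnt_eq) auto
      have y: "y \<ge> 2 * b / 7" unfolding y_def using b x by (rule ln_ratio_lower)
      have lw: "ln (norm w) - ln (R + 3 * \<delta>) \<ge> y"
      proof -
        have "ln (R + 3 * \<delta>) \<le> ln ((1 + b / 4) * R)" using \<delta> R b by (intro ln_mono) (auto simp: field_simps)
        also have "\<dots> = ln (1 + b / 4) + ln R" using R b by (intro ln_mult_pos) auto
        finally have "ln (R + 3 * \<delta>) \<le> ln (1 + b / 4) + ln R" .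
        moreover have "norm w = x * R" using R by (simp add: x_def)
        then have "ln (norm w) = ln x + ln R" using x0 R by (simp add: ln_mult_pos)
        moreover have "y = ln x - ln (1 + b / 4)" unfolding y_def using x0 by (intro ln_divide_pos)
        ultimately show ?thesis by linarith
      qed
      have "logpot (lebesgue_on E) z \<delta> w \<le> (\<integral>t. ln (norm w + R) \<partial>lebesgue_on E)"
        unfolding logpot_def
      proof (rule integral_mono)
        show "integrable (lebesgue_on E) (\<lambda>t. lnt \<delta> (w - z t))"
          using integrable_lnt_diff[OF fin z _ \<delta>(1), of R w] zR sp by auto
        fix t assume "t \<in> space (lebesgue_on E)"
        then have "norm (w - z t) \<le> norm w + R" using zR[of t] norm_triangle_ineq4[of w "z t"] sp by auto
        then show "lnt \<delta> (w - z t) \<le> ln (norm w + R)"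
          unfolding lnt_def using w0 \<delta> R by (intro ln_mono) auto
      qed (auto simp: finite_measure.integrable_const[OF fin])
      then have lp: "logpot (lebesgue_on E) z \<delta> w \<le> m * ln (norm w + R)" using sp ms by simp
      have "ln (norm w + R) - ln m = ln ((x + 1) * (R / m))"
      proof -
        have "(x + 1) * (R / m) = (x * R + R) / m" by (simp add: algebra_simps add_divide_distrib)
        also have "x * R = norm w" using R by (simp add: x_def)
        finally have "(x + 1) * (R / m) = (norm w + R) / m" .
        moreover have "norm w + R > 0" using w0 R by linarith
        ultimately show ?thesis using m(2) by (simp add: ln_divide_pos)
      qed
      also have "\<dots> = ln (x + 1) + ln (R / m)" using x0 R m by (intro ln_mult_pos) auto
      also have "ln (x + 1) \<le> 1 + y"
      proof -
        have "x + 1 \<le> 2 * x" using x b by simp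
        also have "\<dots> = 2 * (1 + b / 4) * exp y"
        proof -
          have "2 * x = 2 * B * (x / B)" if "B > 0" for B using that by simp
          then show ?thesis unfolding y_def using x0 by (metis exp_ln zero_less_divide_iff)
        qed
        also have "\<dots> \<le> exp 1 * exp y"
          using b exp_lower_Taylor_quadratic[of 1] by (intro mult_right_mono) auto
        finally have "x + 1 \<le> exp (1 + y)" by (simp add: exp_add)
        then have "ln (x + 1) \<le> ln (exp (1 + y))" using x0 by (intro ln_mono) auto
        then show ?thesis by simp
      qed
      finally have lx: "ln (norm w + R) - ln m \<le> 1 + y + ln (R / m)" by simp
      define Y where "Y = 7 * y / (2 * b)"
      have Y1: "Y \<ge> 1" using y b by (simp add: Y_def field_simps)
      have Yy: "y \<le> Y" 
      proof -
        have "y \<ge> 0" using y b by (smt (verit) divide_nonneg_pos)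
        moreover have "2 * b \<le> 7" using b by simp
        ultimately have "y * (2 * b) \<le> y * 7" by (intro mult_left_mono)
        then show ?thesis unfolding Y_def using b by (simp add: pos_le_divide_eq mult.commute)
      qed
      have "8 + (1 + y + ln (R / m)) \<le> (9 + ln (R / m)) * Y + Y"
      proof -
        have "(9 + ln (R / m)) * 1 \<le> (9 + ln (R / m)) * Y" using L Y1 by (intro mult_left_mono) auto
        then show ?thesis using Yy by simp
      qed
      also have "\<dots> = (10 + ln (R / m)) * Y" by (simp add: algebra_simps)
      finally have "m * (8 + (1 + y + ln (R / m))) \<le> m * ((10 + ln (R / m)) * Y)"
        using m by (intro mult_left_mono) auto
      also have "\<dots> = K * y" by (simp add: K_def Y_def)
      also have "\<dots> \<le> K * (ln (norm w) - ln (R + 3 * \<delta>))" using lw K0 by (rule mult_left_mono)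
      finally have "m * (8 + (1 + y + ln (R / m))) \<le> K * (ln (norm w) - ln (R + 3 * \<delta>))" .
      moreover have "m * (ln (norm w + R) - ln m) \<le> m * (1 + y + ln (R / m))"
        using lx m by (intro mult_left_mono) auto
      ultimately show ?thesis unfolding circ_eq c_def using lp by (simp add: algebra_simps)
    qed
  qed (use fin z zR sp K0 v v0 vN lsc sm in \<open>auto simp: circ.finite_measure_axioms\<close>)
  then show ?thesis by (simp add: K_def cavg_def)
qed


section \<open>Subharmonic functions\<close>
lemma ereal_integral_mono:
  assumes "\<And>x. x \<in> space M \<Longrightarrow> f x \<le> g x"
  shows "ereal_integral M f \<le> ereal_integral M g"
proof -
  have "(\<integral>\<^sup>+ x. e2ennreal (f x) \<partial>M) \<le> (\<integral>\<^sup>+ x. e2ennreal (g x) \<partial>M)"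
    "(\<integral>\<^sup>+ x. e2ennreal (- g x) \<partial>M) \<le> (\<integral>\<^sup>+ x. e2ennreal (- f x) \<partial>M)"
    using assms by (auto intro!: nn_integral_mono e2ennreal_mono)
  then show ?thesis
    unfolding ereal_integral_def by (intro ereal_minus_mono) (simp_all add: less_eq_ennreal.rep_eq)
qed

lemma ereal_integral_real:
  assumes "integrable M f"
  shows "ereal_integral M (\<lambda>x. ereal (f x)) = ereal (\<integral>x. f x \<partial>M)"
proof -
  have fin: "(\<integral>\<^sup>+ x. ennreal (f x) \<partial>M) < \<infinity>" "(\<integral>\<^sup>+ x. ennreal (- f x) \<partial>M) < \<infinity>"
    using assms by (auto simp: real_integrable_def top.not_eq_extremum)
  then have "enn2ereal (\<integral>\<^sup>+ x. ennreal (f x) \<partial>M) = ereal (enn2real (\<integral>\<^sup>+ x. ennreal (f x) \<partial>M))"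
    "enn2ereal (\<integral>\<^sup>+ x. ennreal (- f x) \<partial>M) = ereal (enn2real (\<integral>\<^sup>+ x. ennreal (- f x) \<partial>M))"
    by (metis enn2ereal_ennreal enn2real_nonneg ennreal_enn2real infinity_ennreal_def)+
  then show ?thesis
    unfolding ereal_integral_def real_lebesgue_integral_def[OF assms] by simp
qed

text \<open>No measurability of \<open>v\<close> is needed for this comparison, because both parts of the integral are monotone.\<close>
lemma circle_mean_le:
  assumes le: "\<And>s. v (of_real \<rho> * cis s) \<le> ereal (g s)"
    and g [measurable]: "g \<in> borel_measurable borel" and B: "\<And>s. \<bar>g s\<bar> \<le> B"
  shows "circle_mean v \<rho> \<le> ereal (\<integral>s. g s \<partial>circ)"
proof -
  have fin: "finite_measure (lebesgue_on {0..2*pi})" by (intro finite_measure_lebesgue_on) simp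
  have gm: "g \<in> borel_measurable (lebesgue_on {0..2*pi})"
    by (intro measurable_restrict_space1 measurable_completion) measurable
  have int: "integrable (lebesgue_on {0..2*pi}) g"
    using B by (intro finite_measure.integrable_const_bound[OF fin, where B=B] gm) auto
  have "ereal_integral (lebesgue_on {0..2*pi}) (\<lambda>s. v (of_real \<rho> * exp (\<i> * of_real s)))
      \<le> ereal_integral (lebesgue_on {0..2*pi}) (\<lambda>s. ereal (g s))"
    using le by (intro ereal_integral_mono) (simp add: cis_conv_exp)
  also have "\<dots> = ereal (\<integral>s. g s \<partial>lebesgue_on {0..2*pi})" by (rule ereal_integral_real[OF int])
  also have "(\<integral>s. g s \<partial>lebesgue_on {0..2*pi}) = (\<integral>s. indicator {0..2*pi} s *\<^sub>R g s \<partial>lebesgue)"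
    by (rule integral_restrict_space) auto
  also have "\<dots> = (\<integral>s. indicator {0..2*pi} s *\<^sub>R g s \<partial>lborel)"
    by (intro integral_completion) measurable
  also have "\<dots> = 2 * pi * (\<integral>s. g s \<partial>circ)"
    by (simp add: circ_integral set_lebesgue_integral_def)
  finally have "circle_mean v \<rho> \<le> ereal (2 * pi * (\<integral>s. g s \<partial>circ)) / ereal (2 * pi)"
    unfolding circle_mean_def by (rule ereal_divide_right_mono) simp
  then show ?thesis by simp
qed

lemma usc_attains_sup:
  fixes F :: "'a :: topological_space \<Rightarrow> ereal"
  assumes K: "compact K" "K \<noteq> {}" and usc: "\<And>c. open {z. F z < c}"
  shows "\<exists>z\<in>K. \<forall>y\<in>K. F y \<le> F z"
proof (rule ccontr)
  assume "\<not> ?thesis"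
  then have no: "\<And>z. z \<in> K \<Longrightarrow> \<exists>y\<in>K. F z < F y" by (auto simp: not_le)
  have "K \<subseteq> (\<Union>y\<in>K. {z. F z < F y})" using no by auto
  then obtain C where C: "C \<subseteq> K" "finite C" "K \<subseteq> (\<Union>y\<in>C. {z. F z < F y})"
    using compactE_image[OF K(1), of K "\<lambda>y. {z. F z < F y}"] usc by metis
  have "C \<noteq> {}" using C(3) K(2) by auto
  then have "Max (F ` C) \<in> F ` C" using C(2) by (intro Max_in) auto
  then obtain y where "y \<in> C" "F y = Max (F ` C)" by auto
  then have y: "y \<in> C" "\<And>x. x \<in> C \<Longrightarrow> F x \<le> F y" using C(2) by auto
  then obtain x where "x \<in> C" "F y < F x" using C by blast
  then show False using y(2)[of x] by simp
qed

lemma subharmonicD: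
  assumes "subharmonic u"
  shows "u z < \<infinity>" "open {z. u z < c}" "\<rho> > 0 \<Longrightarrow> u z \<le> circle_mean (\<lambda>w. u (z + w)) \<rho>"
  using assms by (auto simp: subharmonic_def)

lemma circ_integral_norm_square: "(\<integral>s. (norm (z + of_real h * cis s))\<^sup>2 \<partial>circ) = (norm z)\<^sup>2 + h\<^sup>2"
proof -
  define f where "f s = z \<bullet> cis s" for s
  have [measurable]: "f \<in> borel_measurable borel" unfolding f_def[abs_def] by measurable
  have B: "\<bar>f s\<bar> \<le> norm z" for s using Cauchy_Schwarz_ineq2[of z "cis s"] by (simp add: f_def)
  have "(\<integral>s. f (s + pi) \<partial>circ) = (\<integral>s. f s \<partial>circ)"
    by (rule circ_integral_shift[OF _ B]) (auto simp: f_def cis.ctr)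
  moreover have "f (s + pi) = - f s" for s by (simp add: f_def inner_complex_def)
  ultimately have f0: "(\<integral>s. f s \<partial>circ) = 0" by simp
  have i: "integrable circ f" by (rule circ_integrable[OF _ B]) measurable
  have "(norm (z + of_real h * cis s))\<^sup>2 = (norm z)\<^sup>2 + h\<^sup>2 + 2 * h * f s" for s
  proof -
    have "(norm (z + of_real h * cis s))\<^sup>2 = (norm (z + h *\<^sub>R cis s))\<^sup>2" by (simp add: scaleR_conv_of_real)
    also have "\<dots> = z \<bullet> z + h\<^sup>2 * (cis s \<bullet> cis s) + 2 * h * f s"
      unfolding power2_norm_eq_inner f_def
      by (simp add: inner_add_left inner_add_right inner_commute power2_eq_square algebra_simps)
    finally show ?thesis by (simp add: dot_square_norm)
  qed
  then show ?thesis using i f0 circ.prob_space by simp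
qed

text \<open>Adding \<open>\<epsilon> \<bar>z\<bar>\<^sup>2\<close> makes the mean value inequality strict and so excludes an interior maximum.\<close>
lemma subharmonic_max_principle:
  assumes u: "subharmonic u" and R: "R > 0" and bd: "\<And>z. norm z = R \<Longrightarrow> u z \<le> ereal M"
    and z0: "norm z0 \<le> R"
  shows "u z0 \<le> ereal M"
proof (rule ccontr)
  assume "\<not> ?thesis"
  then have gt: "ereal M < u z0" by simp
  then obtain x where x: "u z0 = ereal x" "M < x"
    using subharmonicD(1)[OF u, of z0] by (cases "u z0") auto
  define \<epsilon> where "\<epsilon> = (x - M) / (2 * R\<^sup>2)"
  have \<epsilon>: "\<epsilon> > 0" "\<epsilon> * R\<^sup>2 < x - M" using x R by (auto simp: \<epsilon>_def)
  define F where "F z = u z + ereal (\<epsilon> * (norm z)\<^sup>2)" for z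
  have "open {z. F z < c}" for c
  proof -
    have "{z. F z < c} = (\<Union>q::real. {z. u z < ereal q} \<inter> {z. ereal (q + \<epsilon> * (norm z)\<^sup>2) < c})"
    proof (intro set_eqI iffI)
      fix z assume "z \<in> {z. F z < c}"
      then have Fc: "F z < c" by simp
      then have "u z < c - ereal (\<epsilon> * (norm z)\<^sup>2)"
        unfolding F_def by (simp add: ereal_less_minus)
      then obtain q where q: "u z < ereal q" "ereal q < c - ereal (\<epsilon> * (norm z)\<^sup>2)"
        using ereal_dense2 by blast
      then have "ereal (q + \<epsilon> * (norm z)\<^sup>2) < c" by (simp add: ereal_less_minus)
      then show "z \<in> (\<Union>q::real. {z. u z < ereal q} \<inter> {z. ereal (q + \<epsilon> * (norm z)\<^sup>2) < c})" using q by blast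
    next
      fix z assume "z \<in> (\<Union>q::real. {z. u z < ereal q} \<inter> {z. ereal (q + \<epsilon> * (norm z)\<^sup>2) < c})"
      then obtain q where q: "u z < ereal q" "ereal (q + \<epsilon> * (norm z)\<^sup>2) < c" by blast
      have "F z \<le> ereal q + ereal (\<epsilon> * (norm z)\<^sup>2)" unfolding F_def using q by (intro add_right_mono) auto
      then show "z \<in> {z. F z < c}" using q by (simp add: le_less_trans)
    qed
    moreover have "open {z. ereal (q + \<epsilon> * (norm z)\<^sup>2) < c}" for q
      by (intro open_Collect_less continuous_on_ereal continuous_intros)
    ultimately show ?thesis using subharmonicD(2)[OF u] by (auto intro!: open_UN open_Int)
  qed
  then obtain y where y: "y \<in> cball 0 R" "\<And>z. z \<in> cball 0 R \<Longrightarrow> F z \<le> F y"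
    using usc_attains_sup[of "cball 0 R" F] R by auto
  have "ereal x \<le> F z0" using x \<epsilon> by (simp add: F_def)
  also have "\<dots> \<le> F y" using y z0 by simp
  finally have Fy: "ereal x \<le> F y" .
  then obtain \<mu> where \<mu>: "F y = ereal \<mu>" "x \<le> \<mu>"
    using subharmonicD(1)[OF u, of y] by (cases "u y") (auto simp: F_def)
  have "norm y \<noteq> R"
  proof
    assume "norm y = R"
    then have "F y \<le> ereal M + ereal (\<epsilon> * R\<^sup>2)" unfolding F_def using bd by (intro add_mono) auto
    then show False using \<mu> \<epsilon> by simp
  qed
  then have yR: "norm y < R" using y by simp
  define h where "h = R - norm y"
  have h: "h > 0" using yR by (simp add: h_def)
  define g where "g s = \<mu> - \<epsilon> * (norm (y + of_real h * cis s))\<^sup>2" for s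
  have nb: "norm (y + of_real h * cis s) \<le> R" for s
  proof -
    have "norm (of_real h * cis s) = R - norm y" using h by (simp add: norm_mult) (simp add: h_def)
    then show ?thesis using norm_triangle_ineq[of y "of_real h * cis s"] by simp
  qed
  have sqb: "(norm (y + of_real h * cis s))\<^sup>2 \<le> R\<^sup>2" for s using nb by (intro power_mono) auto
  have ule: "u z \<le> ereal (\<mu> - \<epsilon> * (norm z)\<^sup>2)" if "norm z \<le> R" for z
    using y(2)[of z] that \<mu> unfolding F_def by (cases "u z") auto
  have "circle_mean (\<lambda>w. u (y + w)) h \<le> ereal (\<integral>s. g s \<partial>circ)"
  proof (rule circle_mean_le)
    show "u (y + of_real h * cis s) \<le> ereal (g s)" for s unfolding g_def using nb by (rule ule)
    show "\<bar>g s\<bar> \<le> \<bar>\<mu>\<bar> + \<epsilon> * R\<^sup>2" for s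
    proof -
      have "0 \<le> \<epsilon> * (norm (y + of_real h * cis s))\<^sup>2" "\<epsilon> * (norm (y + of_real h * cis s))\<^sup>2 \<le> \<epsilon> * R\<^sup>2"
        using sqb[of s] \<epsilon> by (auto intro: mult_left_mono)
      then show ?thesis unfolding g_def by linarith
    qed
    show "g \<in> borel_measurable borel" unfolding g_def[abs_def] by measurable
  qed
  also have "(\<integral>s. g s \<partial>circ) = \<mu> - \<epsilon> * ((norm y)\<^sup>2 + h\<^sup>2)"
  proof -
    have "integrable circ (\<lambda>s. (norm (y + of_real h * cis s))\<^sup>2)"
      using sqb by (intro circ_integrable[where B="R\<^sup>2"]) auto
    then show ?thesis unfolding g_def using circ.prob_space by (simp add: circ_integral_norm_square)
  qed
  finally have "u y \<le> ereal (\<mu> - \<epsilon> * ((norm y)\<^sup>2 + h\<^sup>2))"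
    using subharmonicD(3)[OF u h, of y] by simp
  moreover have "u y = ereal (\<mu> - \<epsilon> * (norm y)\<^sup>2)" using \<mu> unfolding F_def by (cases "u y") auto
  ultimately have "\<epsilon> * h\<^sup>2 \<le> 0" by (simp add: algebra_simps)
  then show False using \<epsilon> h by (simp add: mult_le_0_iff)
qed

text \<open>For \<open>u \<le> M\<close> on the disc of radius \<open>R\<close>: the superharmonic function \<open>M - u\<close> in the open disc, cut off at height \<open>N\<close> to make it
  bounded (also where \<open>u = -\<infinity>\<close>).  The value \<open>0\<close> outside the disc keeps it lower semicontinuous on the whole
  plane.\<close>
definition trunc :: "(complex \<Rightarrow> ereal) \<Rightarrow> real \<Rightarrow> real \<Rightarrow> real \<Rightarrow> complex \<Rightarrow> real" where
  "trunc u M R N z = (if norm z < R then real_of_ereal (min (ereal N) (ereal M - u z)) else 0)"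

context
  fixes u :: "complex \<Rightarrow> ereal" and M R :: real
  assumes u: "subharmonic u" and le: "\<And>z. norm z \<le> R \<Longrightarrow> u z \<le> ereal M"
begin

lemma trunc_eq:
  assumes "N \<ge> 0" "norm z < R"
  shows "ereal (trunc u M R N z) = min (ereal N) (ereal M - u z)"
  using assms le[of z] by (cases "u z") (auto simp: trunc_def min_def)

lemma trunc_nonneg:
  assumes "N \<ge> 0"
  shows "0 \<le> trunc u M R N z"
proof (cases "norm z < R")
  case True
  have "0 \<le> min (ereal N) (ereal M - u z)"
    using assms le[of z] True by (cases "u z") auto
  then show ?thesis using trunc_eq[OF assms True] by (metis ereal_less_eq(5))
qed (simp add: trunc_def)

lemma trunc_le: "N \<ge> 0 \<Longrightarrow> trunc u M R N z \<le> N"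
  using trunc_eq[of N z] by (cases "norm z < R") (auto simp: trunc_def min_le_iff_disj simp flip: ereal_less_eq(3))

lemma trunc_mono: "0 \<le> N \<Longrightarrow> N \<le> N' \<Longrightarrow> trunc u M R N z \<le> trunc u M R N' z"
proof (cases "norm z < R")
  case True
  assume N: "0 \<le> N" "N \<le> N'"
  then have "ereal (trunc u M R N z) \<le> ereal (trunc u M R N' z)"
    using True by (subst (1 2) trunc_eq) (auto intro: min.coboundedI1 min.coboundedI2)
  then show ?thesis by simp
qed (simp add: trunc_def)

lemma le_trunc: "N \<ge> 0 \<Longrightarrow> norm z < R \<Longrightarrow> u z \<le> ereal (M - trunc u M R N z)"
  using trunc_eq[of N z] le[of z] by (cases "u z") (auto simp: min_def split: if_splits)

lemma trunc_lsc:
  assumes N: "N \<ge> 0"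
  shows "open {z. c < trunc u M R N z}"
proof (cases "c < 0")
  case True
  then have "{z. c < trunc u M R N z} = UNIV" using trunc_nonneg[OF N] by (auto intro: less_le_trans)
  then show ?thesis by simp
next
  case False
  have "{z. c < trunc u M R N z} = (if c < N then ball 0 R \<inter> {z. u z < ereal (M - c)} else {})"
  proof (intro set_eqI)
    fix z
    show "z \<in> {z. c < trunc u M R N z} \<longleftrightarrow> z \<in> (if c < N then ball 0 R \<inter> {z. u z < ereal (M - c)} else {})"
    proof (cases "norm z < R")
      case True
      have "c < trunc u M R N z \<longleftrightarrow> ereal c < min (ereal N) (ereal M - u z)"
        by (subst trunc_eq[OF N True, symmetric]) simp
      also have "\<dots> \<longleftrightarrow> c < N \<and> u z < ereal (M - c)"
        by (cases "u z") auto
      finally show ?thesis using True by simp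
    next
      case f: False
      then have "trunc u M R N z = 0" by (simp add: trunc_def)
      then show ?thesis using f False by auto
    qed
  qed
  then show ?thesis using subharmonicD(2)[OF u] by auto
qed

lemma trunc_measurable:
  assumes N: "N \<ge> 0"
  shows "trunc u M R N \<in> borel_measurable borel"
  using trunc_lsc[OF N] by (simp add: borel_measurable_iff_greater)

lemma trunc_supermean:
  assumes N: "N \<ge> 0" and h: "0 < h" "norm w + h < R"
  shows "cavg (trunc u M R N) w h \<le> trunc u M R N w"
proof -
  note [measurable] = trunc_measurable[OF N]
  have nb: "norm (w + of_real h * cis s) < R" for s
    using norm_triangle_ineq[of w "of_real h * cis s"] h by (simp add: norm_mult)
  have b: "\<bar>trunc u M R N z\<bar> \<le> N" for z using trunc_nonneg[OF N] trunc_le[OF N] by (simp add: abs_le_iff)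
  have i: "integrable circ (\<lambda>s. trunc u M R N (w + of_real h * cis s))"
    using b by (intro circ_integrable[where B=N]) auto
  have "u w \<le> circle_mean (\<lambda>z. u (w + z)) h" by (rule subharmonicD(3)[OF u h(1)])
  also have "\<dots> \<le> ereal (\<integral>s. M - trunc u M R N (w + of_real h * cis s) \<partial>circ)"
  proof (rule circle_mean_le)
    show "u (w + of_real h * cis s) \<le> ereal (M - trunc u M R N (w + of_real h * cis s))" for s
      using N nb by (rule le_trunc)
    show "\<bar>M - trunc u M R N (w + of_real h * cis s)\<bar> \<le> \<bar>M\<bar> + N" for s
      using b[of "w + of_real h * cis s"] by linarith
  qed measurable
  also have "(\<integral>s. M - trunc u M R N (w + of_real h * cis s) \<partial>circ) = M - cavg (trunc u M R N) w h"
    using i circ.prob_space by (simp add: cavg_def)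
  finally have "u w \<le> ereal (M - cavg (trunc u M R N) w h)" .
  moreover have "cavg (trunc u M R N) w h \<le> N"
    using cavg_bound[OF trunc_measurable[OF N] b, of w h] by simp
  ultimately have "ereal (cavg (trunc u M R N) w h) \<le> min (ereal N) (ereal M - u w)"
    by (cases "u w") auto
  also have "\<dots> = ereal (trunc u M R N w)" using h N by (intro trunc_eq[symmetric]) auto
  finally show ?thesis by simp
qed

lemma circle_mean_trunc:
  assumes N: "N \<ge> 0" and r: "0 \<le> r" "r < R"
  shows "circle_mean u r \<le> ereal (M - cavg (trunc u M R N) 0 r)"
proof -
  note [measurable] = trunc_measurable[OF N]
  have nb: "norm (of_real r * cis s) < R" for s using r by (simp add: norm_mult)
  have b: "\<bar>trunc u M R N z\<bar> \<le> N" for z using trunc_nonneg[OF N] trunc_le[OF N] by (simp add: abs_le_iff)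
  have i: "integrable circ (\<lambda>s. trunc u M R N (of_real r * cis s))"
    using b by (intro circ_integrable[where B=N]) auto
  have "circle_mean u r \<le> ereal (\<integral>s. M - trunc u M R N (of_real r * cis s) \<partial>circ)"
  proof (rule circle_mean_le)
    show "u (of_real r * cis s) \<le> ereal (M - trunc u M R N (of_real r * cis s))" for s
      using N nb by (rule le_trunc)
    show "\<bar>M - trunc u M R N (of_real r * cis s)\<bar> \<le> \<bar>M\<bar> + N" for s
      using b[of "of_real r * cis s"] by linarith
  qed measurable
  also have "(\<integral>s. M - trunc u M R N (of_real r * cis s) \<partial>circ) = M - cavg (trunc u M R N) 0 r"
    using i circ.prob_space by (simp add: cavg_def)
  finally show ?thesis .
qed

end


section \<open>Suprema over circles\<close>

text \<open>A measurable choice, for each radius \<open>t\<close>, of a point on the circle of radius \<open>\<bar>t\<bar>\<close> at which \<open>v\<close> is at least as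
  large as at the angles \<open>q 0, \<dots>, q n\<close>.\<close>
lemma exists_maximizing_selection:
  fixes q :: "nat \<Rightarrow> real" and v :: "complex \<Rightarrow> real"
  assumes [measurable]: "v \<in> borel_measurable borel"
  shows "\<exists>z \<in> borel_measurable borel. (\<forall>t. norm (z t) = \<bar>t\<bar>) \<and> (\<forall>t. \<forall>j\<le>n. v (of_real t * cis (q j)) \<le> v (z t))"
proof (induction n)
  case 0
  show ?case by (intro bexI[of _ "\<lambda>t. of_real t * cis (q 0)"]) (auto simp: norm_mult)
next
  case (Suc n)
  then obtain z where z [measurable]: "z \<in> borel_measurable borel" and zn: "\<And>t. norm (z t) = \<bar>t\<bar>"
    and zv: "\<And>t j. j \<le> n \<Longrightarrow> v (of_real t * cis (q j)) \<le> v (z t)" by blast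
  define z' where "z' t = (if v (z t) < v (of_real t * cis (q (Suc n))) then of_real t * cis (q (Suc n)) else z t)" for t
  have "z' \<in> borel_measurable borel" unfolding z'_def[abs_def] by measurable
  moreover have "norm (z' t) = \<bar>t\<bar>" for t by (simp add: z'_def zn norm_mult)
  moreover have "v (of_real t * cis (q j)) \<le> v (z' t)" if "j \<le> Suc n" for t j
    using zv[of j t] that by (cases "j = Suc n") (auto simp: z'_def)
  ultimately show ?case by blast
qed

text \<open>The quantity \<open>m + K\<close>, with \<open>K = 7 m (10 + ln (R / m)) / (2 b)\<close>, is absorbed by the first and last factors of the right-hand side of the theorem
  with \<open>a = 100\<close>.\<close>
lemma numeric_bound:
  fixes m b R :: real
  assumes m: "0 < m" "m \<le> R" and b: "0 < b" "b \<le> 1"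
  shows "m + 7 / (2 * b) * m * (10 + ln (R / m))
    \<le> 100 / b * ln (100 / b) * (m + min m (3 * b * R) * ln (3 * exp 1 * b * R / min m (3 * b * R)))"
proof -
  define n where "n = min m (3 * b * R)"
  define l where "l = ln (1 / b)"
  define y where "y = ln (3 * b * R / n)"
  have R: "R > 0" using m by simp
  have n: "0 < n" "n \<le> m" "n \<le> 3 * b * R" using m b R by (auto simp: n_def)
  have l: "l \<ge> 0" using b by (simp add: l_def)
  have y: "y \<ge> 0" using n by (simp add: y_def)
  have e100: "ln (100::real) \<ge> 1"
  proof -
    have "ln (exp 1) \<le> ln (100::real)" using e_less_272 by (intro ln_mono) auto
    then show ?thesis by simp
  qed
  have A: "ln (100 / b) \<ge> 1 + l"
    using b e100 by (simp add: l_def ln_div)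
  have L: "ln (3 * exp 1 * b * R / n) = 1 + y"
  proof -
    have "3 * exp 1 * b * R / n = exp 1 * (3 * b * R / n)" by simp
    also have "ln \<dots> = ln (exp 1) + ln (3 * b * R / n)" using n b R by (intro ln_mult_pos) auto
    finally show ?thesis by (simp add: y_def)
  qed
  have Rm: "m * ln (R / m) \<le> m * l + n * y"
  proof (cases "m \<le> 3 * b * R")
    case True
    then have nm: "n = m" by (simp add: n_def)
    have "ln (R / m) = ln (3 * b * R / m) + ln (1 / (3 * b))"
      using m b R by (subst ln_mult_pos[symmetric]) auto
    also have "ln (1 / (3 * b)) \<le> l" unfolding l_def using b by (intro ln_mono) (auto simp: field_simps)
    finally have "ln (R / m) \<le> y + l" by (simp add: y_def nm)
    then have "m * ln (R / m) \<le> m * (y + l)" using m by (intro mult_left_mono) auto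
    then show ?thesis by (simp add: nm algebra_simps)
  next
    case False
    then have "R / m \<le> 1 / b" using m b R by (simp add: field_simps)
    then have "ln (R / m) \<le> l" unfolding l_def using m R by (intro ln_mono) auto
    then have "m * ln (R / m) \<le> m * l" using m by (intro mult_left_mono) auto
    moreover have "0 \<le> n * y" using n y by simp
    ultimately show ?thesis by linarith
  qed
  have "m + 7 / (2 * b) * m * (10 + ln (R / m)) = m + 7 / (2 * b) * (10 * m + m * ln (R / m))"
  proof -
    have "k * m * (10 + x) = k * (10 * m + m * x)" for k x :: real by (simp add: algebra_simps)
    then show ?thesis by (simp only:)
  qed
  also have "\<dots> \<le> m / b + 7 / (2 * b) * (10 * m + (m * l + n * y))"
  proof (rule add_mono)
    show "m \<le> m / b" using b m by (simp add: pos_le_divide_eq mult_left_le)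
    show "7 / (2 * b) * (10 * m + m * ln (R / m)) \<le> 7 / (2 * b) * (10 * m + (m * l + n * y))"
      using Rm b by (intro mult_left_mono) auto
  qed
  also have "\<dots> = 1 / b * (36 * m + 7 / 2 * (m * l) + 7 / 2 * (n * y))"
    using b by (simp add: field_simps)
  also have "\<dots> \<le> 1 / b * (100 * ((1 + l) * (m + n * (1 + y))))"
  proof (intro mult_left_mono)
    have "0 \<le> m * l" "0 \<le> n * y" "0 \<le> n * l" "0 \<le> l * (n * y)" using m l n y by auto
    then show "36 * m + 7 / 2 * (m * l) + 7 / 2 * (n * y) \<le> 100 * ((1 + l) * (m + n * (1 + y)))"
      using m n by (simp add: algebra_simps)
  qed (use b in auto)
  also have "\<dots> \<le> 1 / b * (100 * (ln (100 / b) * (m + n * (1 + y))))"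
    using A b m n y by (intro mult_left_mono mult_right_mono) auto
  also have "\<dots> = 100 / b * ln (100 / b) * (m + n * ln (3 * exp 1 * b * R / n))"
    unfolding L by simp
  finally show ?thesis unfolding n_def .
qed

text \<open>By upper semicontinuity of \<open>u\<close>, the supremum of \<open>M - u\<close> over a circle is the same as over a
  dense sequence \<open>q\<close> of angles; a single index \<open>n\<close> serves both for the angles and for the height of
  the truncation.\<close>
lemma circle_sup_abs_le_SUP_trunc:
  fixes u :: "complex \<Rightarrow> ereal" and q :: "nat \<Rightarrow> real"
  assumes u: "subharmonic u" and le: "\<And>z. norm z \<le> R \<Longrightarrow> u z \<le> ereal M"
    and q: "\<And>U. open U \<Longrightarrow> U \<noteq> {} \<Longrightarrow> \<exists>j. q j \<in> U" and x: "0 \<le> x" "x < R"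
  shows "circle_sup (\<lambda>z. \<bar>u z\<bar>) x
    \<le> ereal \<bar>M\<bar> + enn2ereal (SUP n. SUP j\<in>{..n}. ennreal (trunc u M R (real n) (of_real x * cis (q j))))"
    (is "_ \<le> _ + enn2ereal ?S")
  unfolding circle_sup_def
proof (rule SUP_least)
  fix z :: complex assume "z \<in> sphere 0 x"
  then have nz: "norm z = x" by simp
  have key: "ereal M - u z \<le> enn2ereal ?S"
  proof (rule ccontr)
    assume "\<not> ?thesis"
    then have "enn2ereal ?S < ereal M - u z" by (simp only: not_le)
    from ereal_dense2[OF this] obtain c where c: "enn2ereal ?S < ereal c" "ereal c < ereal M - u z" by (elim exE conjE)
    have "0 < ereal c" using enn2ereal_nonneg c(1) by (rule order_le_less_trans)
    then have c0: "0 \<le> c" by simp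
    have \<theta>: "z = of_real x * cis (Arg z)"
      using nz rcis_cmod_Arg[of z] by (simp add: rcis_def)
    define \<theta> where "\<theta> = Arg z"
    note \<theta> = \<theta>[folded \<theta>_def]
    define U where "U = (\<lambda>\<theta>. of_real x * cis \<theta>) -` {z. u z < ereal (M - c)}"
    have "open U" unfolding U_def
      using subharmonicD(2)[OF u] by (intro open_vimage) (auto intro!: continuous_intros)
    moreover have "\<theta> \<in> U" using c(2) by (cases "u z") (auto simp: U_def \<theta>[symmetric])
    ultimately obtain j where j: "q j \<in> U" using q by blast
    define n where "n = max j (nat \<lceil>c\<rceil>)"
    have nc: "c \<le> real n" unfolding n_def by linarith
    have "ereal c \<le> ereal (trunc u M R (real n) (of_real x * cis (q j)))"
      using j nc x by (subst trunc_eq[OF u le]) (auto simp: U_def norm_mult, cases "u (of_real x * cis (q j))", auto)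
    then have "ennreal c \<le> ennreal (trunc u M R (real n) (of_real x * cis (q j)))"
      by (intro ennreal_leI) simp
    also have "\<dots> \<le> ?S"
      by (rule SUP_upper2[of n], simp, rule SUP_upper) (simp add: n_def)
    finally have "enn2ereal (ennreal c) \<le> enn2ereal ?S" by (simp add: less_eq_ennreal.rep_eq)
    then show False using c(1) c0 by (simp add: enn2ereal_ennreal)
  qed
  have "\<bar>u z\<bar> \<le> ereal \<bar>M\<bar> + (ereal M - u z)"
    using le[of z] nz x by (cases "u z") auto
  also have "\<dots> \<le> ereal \<bar>M\<bar> + enn2ereal ?S" by (intro add_left_mono key)
  finally show "\<bar>u z\<bar> \<le> ereal \<bar>M\<bar> + enn2ereal ?S" .
qed

lemma exists_dense_sequence: "\<exists>q :: nat \<Rightarrow> real. \<forall>U. open U \<longrightarrow> U \<noteq> {} \<longrightarrow> (\<exists>j. q j \<in> U)"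
proof -
  obtain D :: "real set" where D: "countable D" "\<And>U. open U \<Longrightarrow> U \<noteq> {} \<Longrightarrow> \<exists>d\<in>D. d \<in> U"
    by (rule countable_dense_setE) blast
  have "D \<noteq> {}" using D(2)[of UNIV] by auto
  then have "range (from_nat_into D) = D" using D(1) by (rule range_from_nat_into)
  then show ?thesis using D(2) by (intro exI[of _ "from_nat_into D"]) (metis rangeE)
qed

text \<open>The estimate for \<open>g = 1\<close>.  The measurable majorant \<open>H\<close> stands in for the maximum function, so that no
  measurability of the latter has to be shown.\<close>
lemma nn_integral_circle_sup_bound:
  fixes u :: "complex \<Rightarrow> ereal" and E :: "real set"
  assumes u: "subharmonic u" and R: "R > 0" and b: "0 < b" "b \<le> 1" and r0: "0 \<le> r0" "r0 \<le> R"
    and E: "E \<in> lmeasurable" "E \<subseteq> {0..R}" and m: "m = measure lebesgue E" "m > 0"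
    and le: "\<And>z. norm z \<le> (1 + b) * R \<Longrightarrow> u z \<le> ereal M" and C: "ereal C \<le> circle_mean u r0"
  shows "\<exists>H \<in> borel_measurable (lebesgue_on E). (\<forall>x\<in>E. e2ennreal (circle_sup (\<lambda>z. \<bar>u z\<bar>) x) \<le> H x)
    \<and> (\<integral>\<^sup>+x. H x \<partial>lebesgue_on E) \<le> ennreal (\<bar>M\<bar> * m + 7 / (2 * b) * m * (10 + ln (R / m)) * (M - C))"
proof -
  define R' where "R' = (1 + b) * R"
  have RR: "R < R'" using R b by (simp add: R'_def)
  obtain q :: "nat \<Rightarrow> real" where q: "\<And>U. open U \<Longrightarrow> U \<noteq> {} \<Longrightarrow> \<exists>j. q j \<in> U"
    using exists_dense_sequence by blast
  define K where "K = 7 / (2 * b) * m * (10 + ln (R / m))"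
  define w where "w n = trunc u M R' (real n)" for n
  note le' = le[folded R'_def]
  have w [measurable]: "w n \<in> borel_measurable borel" for n
    unfolding w_def by (rule trunc_measurable[OF u le']) auto
  have w0: "0 \<le> w n z" for n z unfolding w_def by (rule trunc_nonneg[OF u le']) auto
  have wn: "w n z \<le> real n" for n z unfolding w_def by (rule trunc_le[OF u le']) auto
  have wm: "w n z \<le> w n' z" if "n \<le> n'" for n n' z
    unfolding w_def using that by (intro trunc_mono[OF u le']) auto
  have sp: "space (lebesgue_on E) = E" by (simp add: space_restrict_space)
  have fin: "finite_measure (lebesgue_on E)" using E by (intro finite_measure_lebesgue_on)
  have em: "emeasure (lebesgue_on E) E = ennreal m"
    using E m by (simp add: emeasure_restrict_space fmeasurableD emeasure_eq_measure2)
  have mR: "m \<le> R"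
  proof -
    have "m \<le> measure lebesgue {0..R}" unfolding m(1) using E by (intro measure_mono_fmeasurable) (auto simp: fmeasurableD)
    then show ?thesis using R by simp
  qed
  have K0: "K \<ge> 0" unfolding K_def using m(2) mR b by simp
  have mb: "f \<in> borel_measurable (lebesgue_on E)" if "f \<in> borel_measurable borel" for f :: "real \<Rightarrow> 'z::topological_space"
    using that by (intro measurable_restrict_space1 measurable_completion) simp
  define s where "s n x = (SUP j\<in>{..n}. ennreal (w n (of_real x * cis (q j))))" for n x
  have sb: "s n \<in> borel_measurable borel" for n unfolding s_def[abs_def] by measurable
  have inc: "incseq s"
  proof (intro incseq_SucI le_funI)
    fix n x
    show "s n x \<le> s (Suc n) x"
      unfolding s_def
    proof (rule SUP_least)
      fix j assume "j \<in> {..n}"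
      then show "ennreal (w n (of_real x * cis (q j))) \<le> (SUP j\<in>{..Suc n}. ennreal (w (Suc n) (of_real x * cis (q j))))"
        by (intro SUP_upper2[of j] ennreal_leI wm) auto
    qed
  qed
  have int_s: "(\<integral>\<^sup>+x. s n x \<partial>lebesgue_on E) \<le> ennreal (K * (M - C))" for n
  proof -
    obtain z where z: "z \<in> borel_measurable borel" "\<And>t. norm (z t) = \<bar>t\<bar>"
      "\<And>t j. j \<le> n \<Longrightarrow> w n (of_real t * cis (q j)) \<le> w n (z t)"
      using exists_maximizing_selection[OF w[of n], of n q] by blast
    have zE [measurable]: "z \<in> borel_measurable (lebesgue_on E)" using z(1) by (rule mb)
    have zn: "norm (z t) = t" if "t \<in> E" for t using z(2)[of t] that E(2) by auto
    have int: "integrable (lebesgue_on E) (\<lambda>t. w n (z t))"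
      using w0 wn by (intro finite_measure.integrable_const_bound[OF fin, where B="real n"]) auto
    have "(\<integral>\<^sup>+x. s n x \<partial>lebesgue_on E) \<le> (\<integral>\<^sup>+x. ennreal (w n (z x)) \<partial>lebesgue_on E)"
      unfolding s_def using z(3) by (intro nn_integral_mono SUP_least ennreal_leI) auto
    also have "\<dots> = ennreal (\<integral>x. w n (z x) \<partial>lebesgue_on E)"
      using int w0 by (intro nn_integral_eq_integral) auto
    also have "\<dots> \<le> ennreal (K * cavg (w n) 0 r0)"
    proof (rule ennreal_leI)
      show "(\<integral>x. w n (z x) \<partial>lebesgue_on E) \<le> K * cavg (w n) 0 r0"
        unfolding K_def
      proof (rule superharmonic_selection_bound[OF E zE zn m r0 R b w w0 wn])
        show "open {z. c < w n z}" for c unfolding w_def by (rule trunc_lsc[OF u le']) auto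
        show "cavg (w n) y h \<le> w n y" if "0 < h" "norm y + h < (1 + b) * R" for y h
          unfolding w_def using that by (intro trunc_supermean[OF u le']) (auto simp: R'_def)
      qed
    qed
    also have "\<dots> \<le> ennreal (K * (M - C))"
    proof (intro ennreal_leI mult_left_mono K0)
      have "circle_mean u r0 \<le> ereal (M - cavg (w n) 0 r0)"
        unfolding w_def using r0 RR by (intro circle_mean_trunc[OF u le']) auto
      with C have "ereal C \<le> ereal (M - cavg (w n) 0 r0)" by (rule order_trans)
      then show "cavg (w n) 0 r0 \<le> M - C" by simp
    qed
    finally show ?thesis .
  qed
  define H where "H x = ennreal \<bar>M\<bar> + (SUP n. s n x)" for x
  have Hm: "H \<in> borel_measurable (lebesgue_on E)"
    unfolding H_def[abs_def] using sb by (intro mb) auto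
  have KV: "0 \<le> K * (M - C)"
  proof -
    have "circle_mean u r0 \<le> ereal (M - cavg (w 0) 0 r0)"
      unfolding w_def using r0 RR by (intro circle_mean_trunc[OF u le']) auto
    with C have "ereal C \<le> ereal (M - cavg (w 0) 0 r0)" by (rule order_trans)
    moreover have "0 \<le> cavg (w 0) 0 r0" unfolding cavg_def using w0 by (intro Bochner_Integration.integral_nonneg)
    ultimately show ?thesis using K0 by simp
  qed
  show ?thesis
  proof (intro bexI[of _ H] conjI ballI Hm)
    fix x assume "x \<in> E"
    then have "circle_sup (\<lambda>z. \<bar>u z\<bar>) x \<le> ereal \<bar>M\<bar> + enn2ereal (SUP n. s n x)"
      unfolding s_def w_def using E(2) RR by (intro circle_sup_abs_le_SUP_trunc[OF u le' q]) auto
    also have "\<dots> = enn2ereal (H x)"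
      by (simp add: H_def plus_ennreal.rep_eq enn2ereal_ennreal)
    finally have "e2ennreal (circle_sup (\<lambda>z. \<bar>u z\<bar>) x) \<le> e2ennreal (enn2ereal (H x))" by (rule e2ennreal_mono)
    then show "e2ennreal (circle_sup (\<lambda>z. \<bar>u z\<bar>) x) \<le> H x" by simp
  next
    have "(\<integral>\<^sup>+x. H x \<partial>lebesgue_on E) = (\<integral>\<^sup>+x. ennreal \<bar>M\<bar> \<partial>lebesgue_on E) + (\<integral>\<^sup>+x. (SUP n. s n x) \<partial>lebesgue_on E)"
      unfolding H_def using mb[OF sb] by (intro nn_integral_add) auto
    also have "(\<integral>\<^sup>+x. (SUP n. s n x) \<partial>lebesgue_on E) = (SUP n. \<integral>\<^sup>+x. s n x \<partial>lebesgue_on E)"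
      by (intro nn_integral_monotone_convergence_SUP inc mb sb)
    also have "\<dots> \<le> ennreal (K * (M - C))" by (intro SUP_least int_s)
    also have "(\<integral>\<^sup>+x. ennreal \<bar>M\<bar> \<partial>lebesgue_on E) = ennreal (\<bar>M\<bar> * m)"
      using m by (simp add: sp em ennreal_mult)
    also have "ennreal (\<bar>M\<bar> * m) + ennreal (K * (M - C)) = ennreal (\<bar>M\<bar> * m + K * (M - C))"
      using m KV by (intro ennreal_plus[symmetric]) auto
    finally show "(\<integral>\<^sup>+x. H x \<partial>lebesgue_on E) \<le> ennreal (\<bar>M\<bar> * m + 7 / (2 * b) * m * (10 + ln (R / m)) * (M - C))"
      unfolding K_def by (simp add: add_mono)
  qed
qed


section \<open>The integral inequality\<close>
lemma circle_sup_less_infinity: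
  assumes u: "subharmonic u" and R: "0 \<le> R"
  shows "circle_sup u R < \<infinity>"
proof -
  have "of_real R \<in> sphere (0::complex) R" using R by simp
  then have "sphere (0::complex) R \<noteq> {}" by blast
  from usc_attains_sup[OF compact_sphere this subharmonicD(2)[OF u]]
  obtain z where "\<forall>y\<in>sphere 0 R. u y \<le> u z" by blast
  then have "circle_sup u R \<le> u z" unfolding circle_sup_def by (intro SUP_least) blast
  then show ?thesis using subharmonicD(1)[OF u, of z] by (rule le_less_trans)
qed

lemma circle_mean_le_circle_sup:
  assumes u: "subharmonic u" and r: "0 \<le> r" "r \<le> R" "0 < R" and le: "circle_sup u R \<le> ereal M"
  shows "circle_mean u r \<le> ereal M"
proof -
  have max: "u z \<le> ereal M" if "norm z \<le> R" for z
  proof (rule subharmonic_max_principle[OF u r(3) _ that])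
    show "u y \<le> ereal M" if "norm y = R" for y
      using that le unfolding circle_sup_def by (intro order_trans[OF SUP_upper le[unfolded circle_sup_def]]) auto
  qed
  have "circle_mean u r \<le> ereal (\<integral>s. M \<partial>circ)"
    using r by (intro circle_mean_le[where B="\<bar>M\<bar>"] max) (auto simp: norm_mult)
  then show ?thesis using circ.prob_space by simp
qed

lemma abs_ereal_nonneg: "0 \<le> \<bar>x :: ereal\<bar>"
  by (cases x) auto

lemma e2ennreal_mult:
  assumes "0 \<le> x" "0 \<le> y"
  shows "e2ennreal (x * y) = e2ennreal x * e2ennreal y"
proof -
  have "enn2ereal (e2ennreal x * e2ennreal y) = x * y"
    using assms by (simp add: times_ennreal.rep_eq enn2ereal_e2ennreal)
  then show ?thesis by (metis e2ennreal_enn2ereal)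
qed

theorem mainTheorem1:
  shows "\<exists>a::real. a \<ge> 1 \<and>
    (\<forall>(u :: complex \<Rightarrow> ereal) (r0::real) (r::real) (R::real) (E :: real set)
       (g :: real \<Rightarrow> ereal) (b::real).
      subharmonic u \<longrightarrow> (\<exists>z. u z \<noteq> -\<infinity>) \<longrightarrow>
      0 \<le> r0 \<longrightarrow> r0 \<le> r \<longrightarrow> r < R \<longrightarrow>
      E \<in> sets lebesgue \<longrightarrow> E \<subseteq> {r..R} \<longrightarrow>
      g \<in> borel_measurable (lebesgue_on E) \<longrightarrow>
      0 < b \<longrightarrow> b \<le> 1 \<longrightarrow>
      ereal_integral (lebesgue_on E) (\<lambda>x. circle_sup (\<lambda>z. \<bar>u z\<bar>) x * g x)
        \<le> ereal (a / b * ln (a / b))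
          * (circle_sup u ((1 + b) * R) - 2 * min 0 (circle_mean u r0))
          * esssup (lebesgue_on E) (\<lambda>x. \<bar>g x\<bar>)
          * ereal (measure lebesgue E
              + min (measure lebesgue E) (3 * b * R)
                * ln (3 * exp 1 * b * R / min (measure lebesgue E) (3 * b * R))))"
proof (intro exI[of _ 100] conjI allI impI)
  fix u :: "complex \<Rightarrow> ereal" and r0 r R :: real and E :: "real set" and g :: "real \<Rightarrow> ereal" and b :: real
  assume u: "subharmonic u" and r0: "0 \<le> r0" "r0 \<le> r" "r < R"
    and E: "E \<in> sets lebesgue" "E \<subseteq> {r..R}" and b: "0 < b" "b \<le> 1"
  define m where "m = measure lebesgue E"
  define A where "A = 100 / b * ln (100 / b)"
  define L where "L = m + min m (3 * b * R) * ln (3 * exp 1 * b * R / min m (3 * b * R))"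
  define F where "F = circle_sup u ((1 + b) * R) - 2 * min 0 (circle_mean u r0)"
  define S where "S = esssup (lebesgue_on E) (\<lambda>x. \<bar>g x\<bar>)"
  define f where "f x = circle_sup (\<lambda>z. \<bar>u z\<bar>) x * g x" for x
  have R: "R > 0" using r0 by simp
  have E0: "E \<subseteq> {0..R}" using E r0 by auto
  have EL: "E \<in> lmeasurable"
    by (rule fmeasurableI2[OF _ E(2) E(1)]) simp
  have sp: "space (lebesgue_on E) = E" by (simp add: space_restrict_space)
  have em: "emeasure (lebesgue_on E) E = ennreal m"
    using EL m_def by (simp add: emeasure_restrict_space fmeasurableD emeasure_eq_measure2)
  have int_le: "ereal_integral (lebesgue_on E) f \<le> enn2ereal (\<integral>\<^sup>+x. e2ennreal (f x) \<partial>lebesgue_on E)"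
    unfolding ereal_integral_def by (rule ereal_diff_le_self) simp
  have "ereal_integral (lebesgue_on E) f \<le> ereal A * F * S * ereal L"
  proof (cases "m = 0")
    case True
    \<comment> \<open>The essential supremum over a null set is \<open>-\<infinity>\<close>, but the last factor of the bound is \<open>0\<close>.\<close>
    then have "emeasure (lebesgue_on E) (space (lebesgue_on E)) = 0" using em sp by simp
    then have "AE x in lebesgue_on E. e2ennreal (f x) = 0" 
      by (intro AE_I[of _ _ "space (lebesgue_on E)"]) auto
    then have "(\<integral>\<^sup>+x. e2ennreal (f x) \<partial>lebesgue_on E) = (\<integral>\<^sup>+x. 0 \<partial>lebesgue_on E)"
      by (rule nn_integral_cong_AE)
    then have "ereal_integral (lebesgue_on E) f \<le> 0" using int_le by (simp add: zero_ennreal.rep_eq)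
    moreover have "L = 0" using True R b by (simp add: L_def)
    ultimately show ?thesis by (simp add: zero_ereal_def[symmetric])
  next
    case False
    then have m: "m > 0" by (simp add: m_def zero_less_measure_iff)
    have mR: "m \<le> R"
    proof -
      have "m \<le> measure lebesgue {0..R}" unfolding m_def using E0 EL by (intro measure_mono_fmeasurable) (auto simp: fmeasurableD)
      then show ?thesis using R by simp
    qed
    have nb: "m + 7 / (2 * b) * m * (10 + ln (R / m)) \<le> A * L"
      unfolding A_def L_def by (rule numeric_bound[OF m mR b])
    have K0: "7 / (2 * b) * m * (10 + ln (R / m)) \<ge> 0" using m mR b by simp
    have "100 / b \<ge> 100" using b by (simp add: pos_le_divide_eq)
    then have A: "A > 0" unfolding A_def using b by (intro mult_pos_pos) auto
    have "A * L > 0" using nb K0 m by linarith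
    then have L: "L > 0" using A by (simp add: zero_less_mult_iff)
    have S0: "0 \<le> S"
    proof -
      have "AE x in lebesgue_on E. \<bar>g x\<bar> \<le> S" unfolding S_def by (rule esssup_AE)
      then have S: "AE x in lebesgue_on E. 0 \<le> S"
        by eventually_elim (rule order_trans[OF abs_ereal_nonneg])
      have "\<not> (AE x in lebesgue_on E. False)"
        using em sp m by (simp add: AE_iff_measurable[OF _ refl])
      then show ?thesis using S by (cases "0 \<le> S") simp_all
    qed
    have b1: "circle_sup u ((1 + b) * R) < \<infinity>" using R b by (intro circle_sup_less_infinity u) auto
    have RR: "0 < (1 + b) * R" "r0 \<le> (1 + b) * R" 
    proof -
      have "0 < b * R" using R b by simp
      moreover have "(1 + b) * R = R + b * R" by (simp add: algebra_simps)
      ultimately show "0 < (1 + b) * R" "r0 \<le> (1 + b) * R" using r0 by linarith+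
    qed
    have Cle: "circle_mean u r0 \<le> ereal M" if "circle_sup u ((1 + b) * R) \<le> ereal M" for M
      using u r0(1) RR(2,1) that by (rule circle_mean_le_circle_sup)
    show ?thesis
    proof (cases "circle_mean u r0 = -\<infinity>")
      case True
      \<comment> \<open>The minimum is \<open>-\<infinity>\<close> here, and \<open>\<infinity>\<close> absorbs the summand \<open>circle_sup u ((1 + b) * R)\<close> even if that is \<open>-\<infinity>\<close>.\<close>
      then have "F = \<infinity>" by (cases "circle_sup u ((1 + b) * R)") (auto simp: F_def min_def)
      show ?thesis
      proof (cases "S = 0")
        case True
        have "AE x in lebesgue_on E. \<bar>g x\<bar> \<le> S" unfolding S_def by (rule esssup_AE)
        then have "AE x in lebesgue_on E. e2ennreal (f x) = 0"
        proof eventually_elim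
          fix x assume "\<bar>g x\<bar> \<le> S"
          then have "g x = 0" using True by (cases "g x") auto
          then show "e2ennreal (f x) = 0" by (simp add: f_def e2ennreal_neg)
        qed
        then have "(\<integral>\<^sup>+x. e2ennreal (f x) \<partial>lebesgue_on E) = (\<integral>\<^sup>+x. 0 \<partial>lebesgue_on E)"
          by (rule nn_integral_cong_AE)
        then show ?thesis using int_le True by (simp add: zero_ennreal.rep_eq)
      next
        case False
        then have inf: "ereal A * F * S * ereal L = \<infinity>"
          using \<open>F = \<infinity>\<close> A L S0 by (cases S) auto
        show ?thesis unfolding inf by simp
      qed
    next
      case False
      have "circle_sup u ((1 + b) * R) \<noteq> -\<infinity>"
      proof
        assume "circle_sup u ((1 + b) * R) = -\<infinity>"
        then have "circle_mean u r0 \<le> ereal M" for M by (intro Cle) simp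
        then have "circle_mean u r0 = -\<infinity>" by (metis ereal_bot)
        then show False using False by simp
      qed
      then obtain M where M: "circle_sup u ((1 + b) * R) = ereal M" using b1 by (cases "circle_sup u ((1 + b) * R)") auto
      have "circle_mean u r0 \<le> ereal M" using M by (intro Cle) simp
      then obtain C where C: "circle_mean u r0 = ereal C" "C \<le> M" using False by (cases "circle_mean u r0") auto
      define B where "B = M - 2 * min 0 C"
      have FB: "F = ereal B" by (simp add: F_def M C B_def zero_ereal_def min_def)
      have MB: "\<bar>M\<bar> \<le> B" "M - C \<le> B" using C(2) unfolding B_def by linarith+
      have le: "u z \<le> ereal M" if "norm z \<le> (1 + b) * R" for z
      proof (rule subharmonic_max_principle[OF u RR(1) _ that])
        show "u y \<le> ereal M" if "norm y = (1 + b) * R" for y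
          unfolding M[symmetric] circle_sup_def using that by (intro SUP_upper) auto
      qed
      obtain H where H [measurable]: "H \<in> borel_measurable (lebesgue_on E)"
        and Hs: "\<And>x. x \<in> E \<Longrightarrow> e2ennreal (circle_sup (\<lambda>z. \<bar>u z\<bar>) x) \<le> H x"
        and Hi: "(\<integral>\<^sup>+x. H x \<partial>lebesgue_on E) \<le> ennreal (\<bar>M\<bar> * m + 7 / (2 * b) * m * (10 + ln (R / m)) * (M - C))"
        using nn_integral_circle_sup_bound[OF u R b r0(1) _ EL E0 m_def m le, of C] r0 C(1) by auto
      have "\<bar>M\<bar> * m + 7 / (2 * b) * m * (10 + ln (R / m)) * (M - C)
          \<le> B * m + 7 / (2 * b) * m * (10 + ln (R / m)) * B"
        using MB m K0 by (intro add_mono mult_right_mono mult_left_mono) auto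
      also have "\<dots> = B * (m + 7 / (2 * b) * m * (10 + ln (R / m)))" by (simp add: algebra_simps)
      also have "\<dots> \<le> B * (A * L)" using nb MB by (intro mult_left_mono) auto
      finally have Hi': "(\<integral>\<^sup>+x. H x \<partial>lebesgue_on E) \<le> ennreal (B * (A * L))"
        using Hi by (meson ennreal_leI order_trans)
      have "(\<integral>\<^sup>+x. e2ennreal (f x) \<partial>lebesgue_on E) \<le> (\<integral>\<^sup>+x. e2ennreal S * H x \<partial>lebesgue_on E)"
      proof (rule nn_integral_mono_AE)
        have "AE x in lebesgue_on E. \<bar>g x\<bar> \<le> S" unfolding S_def by (rule esssup_AE)
        then have "AE x in lebesgue_on E. \<bar>g x\<bar> \<le> S \<and> x \<in> E" using AE_space sp by (auto elim: eventually_elim2)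
        then show "AE x in lebesgue_on E. e2ennreal (f x) \<le> e2ennreal S * H x"
        proof eventually_elim
          fix x assume x: "\<bar>g x\<bar> \<le> S \<and> x \<in> E"
          have "x \<ge> 0" using x E0 by auto
          then have "of_real x \<in> sphere (0::complex) x" by simp
          then have "\<bar>u (of_real x)\<bar> \<le> circle_sup (\<lambda>z. \<bar>u z\<bar>) x" unfolding circle_sup_def by (rule SUP_upper)
          then have cs: "0 \<le> circle_sup (\<lambda>z. \<bar>u z\<bar>) x" by (meson abs_ereal_nonneg order_trans)
          have "g x \<le> \<bar>g x\<bar>" by (cases "g x") auto
          then have "g x \<le> S" using x by (auto intro: order_trans)
          then have "f x \<le> S * circle_sup (\<lambda>z. \<bar>u z\<bar>) x"
            unfolding f_def using cs by (metis ereal_mult_left_mono mult.commute)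
          then have "e2ennreal (f x) \<le> e2ennreal S * e2ennreal (circle_sup (\<lambda>z. \<bar>u z\<bar>) x)"
            using cs S0 by (metis e2ennreal_mono e2ennreal_mult)
          also have "\<dots> \<le> e2ennreal S * H x" using Hs x by (intro mult_left_mono) auto
          finally show "e2ennreal (f x) \<le> e2ennreal S * H x" .
        qed
      qed
      also have "\<dots> = e2ennreal S * (\<integral>\<^sup>+x. H x \<partial>lebesgue_on E)" by (rule nn_integral_cmult) measurable
      also have "\<dots> \<le> e2ennreal S * ennreal (B * (A * L))" by (intro mult_left_mono Hi') auto
      finally have "enn2ereal (\<integral>\<^sup>+x. e2ennreal (f x) \<partial>lebesgue_on E) \<le> enn2ereal (e2ennreal S * ennreal (B * (A * L)))"
        by (simp add: less_eq_ennreal.rep_eq)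
      also have "\<dots> = S * ereal (B * (A * L))"
        using S0 MB A L by (simp add: times_ennreal.rep_eq enn2ereal_e2ennreal enn2ereal_ennreal)
      also have "\<dots> = ereal A * F * S * ereal L"
      proof -
        have "ereal (B * (A * L)) = ereal A * ereal B * ereal L" by simp
        then show ?thesis unfolding FB by (simp only: mult.assoc mult.commute mult.left_commute)
      qed
      finally show ?thesis using int_le by (rule order_trans[rotated])
    qed
  qed
  then show "ereal_integral (lebesgue_on E) (\<lambda>x. circle_sup (\<lambda>z. \<bar>u z\<bar>) x * g x)
        \<le> ereal (100 / b * ln (100 / b))
          * (circle_sup u ((1 + b) * R) - 2 * min 0 (circle_mean u r0))
          * esssup (lebesgue_on E) (\<lambda>x. \<bar>g x\<bar>)
          * ereal (measure lebesgue E
              + min (measure lebesgue E) (3 * b * R)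
                * ln (3 * exp 1 * b * R / min (measure lebesgue E) (3 * b * R)))"
    unfolding f_def[abs_def] A_def F_def S_def L_def m_def .
qed simp

end
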